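(* Let $S=\{u=F(x,y)\}\subset\mathbb{R}^3$ be a real-analytic parabolic surface, i.e. $F_{xx}\neq0\equiv F_{xx}F_{yy}-F_{xy}^2$. Then, locally, $S$ is - a cylinder if and only if $\mathsf S\equiv0$; - a cone if and only if $\mathsf S\neq0$ and $\mathsf W\equiv0$; - a tangential surface if and only if $\mathsf S\ne0$ and $\mathsf W\ne0$.
   Context: $$\mathsf S=\frac{F_{xx}F_{xxy}-F_{xy}F_{xxx}}{F_{xx}^2},\qquad \mathsf W=\frac{F_{xx}^2F_{xxxy}-F_{xx}F_{xy}F_{xxxx}+2F_{xy}F_{xxx}^2-2F_{xx}F_{xxx}F_{xxy}}{F_{xx}^2(F_{xx}F_{xxy}-F_{xy}F_{xxx})^{2/3}}$$ (real cube root). "$\neq0$" means nowhere zero; by standing convention each of $\mathsf S$ and, when $\mathsf S\ne0$, $\mathsf W$ is assumed either to vanish identically or to vanish nowhere on the surface. A ruled surface is one parametrized by a family of lines (rulers) $\vec x(t,v)=\vec\alpha(t)+v\,\vec w(t)$; it is developable if $\det(\vec w,\vec w',\vec\alpha')\equiv0$; parabolic surfaces are (locally) developable. A developable surface is a cylinder if all rulers are parallel, a cone if all rulers pass through one common point, a tangential surface if all rulers are tangent to a certain curve in $\mathbb{R}^3$ (the surface being then parametrized by $\vec x(t,v)=\vec\alpha(t)+v\,\vec\alpha'(t)$). Surfaces and curves are assumed real-analytic, and statements concern smooth points, locally. *)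

theory Defs
  imports "HOL-Analysis.Analysis"
begin

text \<open>Real-analyticity: local expandability into convergent power series, for functions of two
  real variables (the power series being summed unconditionally) and for curves.\<close>

definition real_analytic2_on :: "(real \<Rightarrow> real \<Rightarrow> real) \<Rightarrow> (real \<times> real) set \<Rightarrow> bool" where
  "real_analytic2_on F U \<longleftrightarrow>
     (\<forall>(a, b) \<in> U. \<exists>r > 0. \<exists>c :: nat \<Rightarrow> nat \<Rightarrow> real.
        \<forall>x y. \<bar>x - a\<bar> < r \<longrightarrow> \<bar>y - b\<bar> < r \<longrightarrow>
          ((\<lambda>(i, j). c i j * (x - a) ^ i * (y - b) ^ j) has_sum F x y) UNIV)"

definition real_analytic_curve_on :: "(real \<Rightarrow> real ^ 3) \<Rightarrow> real set \<Rightarrow> bool" where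
  "real_analytic_curve_on \<gamma> I \<longleftrightarrow>
     (\<forall>a \<in> I. \<exists>r > 0. \<exists>c :: nat \<Rightarrow> real ^ 3.
        \<forall>t. \<bar>t - a\<bar> < r \<longrightarrow> (\<lambda>n. (t - a) ^ n *\<^sub>R c n) sums \<gamma> t)"

definition Dx :: "(real \<Rightarrow> real \<Rightarrow> real) \<Rightarrow> real \<Rightarrow> real \<Rightarrow> real" where
  "Dx F x y = deriv (\<lambda>s. F s y) x"

definition Dy :: "(real \<Rightarrow> real \<Rightarrow> real) \<Rightarrow> real \<Rightarrow> real \<Rightarrow> real" where
  "Dy F x y = deriv (\<lambda>s. F x s) y"

text \<open>The two invariants. In a subscript such as \<open>xxy\<close> the derivatives are taken from left to
  right. The function \<open>root 3\<close> is the real cube root, also for negative arguments, so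
  \<open>(root 3 z)\<^sup>2\<close> renders the power of \<open>z\<close> with exponent 2/3.
  By division by zero, \<open>inv_W\<close> is meaningful only where \<open>inv_S\<close> does not vanish.\<close>

definition inv_S :: "(real \<Rightarrow> real \<Rightarrow> real) \<Rightarrow> real \<Rightarrow> real \<Rightarrow> real" where
  "inv_S F x y =
    (let Fxx = Dx (Dx F) x y; Fxy = Dy (Dx F) x y;
         Fxxx = Dx (Dx (Dx F)) x y; Fxxy = Dy (Dx (Dx F)) x y
     in (Fxx * Fxxy - Fxy * Fxxx) / Fxx ^ 2)"

definition inv_W :: "(real \<Rightarrow> real \<Rightarrow> real) \<Rightarrow> real \<Rightarrow> real \<Rightarrow> real" where
  "inv_W F x y =
    (let Fxx = Dx (Dx F) x y; Fxy = Dy (Dx F) x y;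
         Fxxx = Dx (Dx (Dx F)) x y; Fxxy = Dy (Dx (Dx F)) x y;
         Fxxxx = Dx (Dx (Dx (Dx F))) x y; Fxxxy = Dy (Dx (Dx (Dx F))) x y
     in (Fxx ^ 2 * Fxxxy - Fxx * Fxy * Fxxxx + 2 * Fxy * Fxxx ^ 2 - 2 * Fxx * Fxxx * Fxxy)
        / (Fxx ^ 2 * (root 3 (Fxx * Fxxy - Fxy * Fxxx)) ^ 2))"

definition graph_over :: "(real \<Rightarrow> real \<Rightarrow> real) \<Rightarrow> (real \<times> real) set \<Rightarrow> (real ^ 3) set" where
  "graph_over F V = (\<lambda>(x, y). vector [x, y, F x y]) ` V"

definition ruler :: "(real \<Rightarrow> real ^ 3) \<Rightarrow> (real \<Rightarrow> real ^ 3) \<Rightarrow> real \<Rightarrow> (real ^ 3) set" where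
  "ruler \<alpha> w t = range (\<lambda>v. \<alpha> t + v *\<^sub>R w t)"

abbreviation velocity :: "(real \<Rightarrow> real ^ 3) \<Rightarrow> real \<Rightarrow> real ^ 3" where
  "velocity \<gamma> t \<equiv> vector_derivative \<gamma> (at t)"

text \<open>The set \<open>M\<close> is a smooth ruled surface parametrized by \<open>x(t,v) = \<alpha>(t) + v w(t)\<close> with
  \<open>t \<in> I\<close> and \<open>v \<in> J\<close>. The condition on the cross product of the partial derivatives
  \<open>x\<^sub>t\<close> and \<open>x\<^sub>v\<close> says that the parametrization is an immersion (all points are smooth);
  in particular \<open>w\<close> vanishes nowhere, so that every ruler is a line.\<close>

definition ruled_by ::
  "(real ^ 3) set \<Rightarrow> (real \<Rightarrow> real ^ 3) \<Rightarrow> (real \<Rightarrow> real ^ 3) \<Rightarrow> real set \<Rightarrow> real set \<Rightarrow> bool" where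
  "ruled_by M \<alpha> w I J \<longleftrightarrow>
     open I \<and> is_interval I \<and> open J \<and> is_interval J \<and>
     real_analytic_curve_on \<alpha> I \<and> real_analytic_curve_on w I \<and>
     inj_on (\<lambda>(t, v). \<alpha> t + v *\<^sub>R w t) (I \<times> J) \<and>
     (\<forall>t\<in>I. \<forall>v\<in>J. cross3 (velocity \<alpha> t + v *\<^sub>R velocity w t) (w t) \<noteq> 0) \<and>
     M = (\<lambda>(t, v). \<alpha> t + v *\<^sub>R w t) ` (I \<times> J)"

definition developable_by ::
  "(real ^ 3) set \<Rightarrow> (real \<Rightarrow> real ^ 3) \<Rightarrow> (real \<Rightarrow> real ^ 3) \<Rightarrow> real set \<Rightarrow> real set \<Rightarrow> bool" where
  "developable_by M \<alpha> w I J \<longleftrightarrow>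
     ruled_by M \<alpha> w I J \<and>
     (\<forall>t\<in>I. det (vector [w t, velocity w t, velocity \<alpha> t] :: real ^ 3 ^ 3) = 0)"

definition is_cylinder :: "(real ^ 3) set \<Rightarrow> bool" where
  "is_cylinder M \<longleftrightarrow>
     (\<exists>\<alpha> w I J. developable_by M \<alpha> w I J \<and> (\<forall>s\<in>I. \<forall>t\<in>I. \<exists>k. w s = k *\<^sub>R w t))"

definition is_cone :: "(real ^ 3) set \<Rightarrow> bool" where
  "is_cone M \<longleftrightarrow>
     (\<exists>\<alpha> w I J. developable_by M \<alpha> w I J \<and> (\<exists>q. \<forall>t\<in>I. q \<in> ruler \<alpha> w t))"

text \<open>In a tangential surface the ruler with parameter \<open>t\<close> is the tangent of \<open>\<alpha>\<close> at \<open>\<alpha>(t)\<close>. As \<open>J\<close>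
  is an arbitrary interval, the curve itself need not lie in \<open>M\<close>; the immersion condition
  forces \<open>0 \<notin> J\<close> (unless \<open>M\<close> is empty).\<close>

definition is_tangential :: "(real ^ 3) set \<Rightarrow> bool" where
  "is_tangential M \<longleftrightarrow> (\<exists>\<alpha> I J. developable_by M \<alpha> (velocity \<alpha>) I J)"

text \<open>The surface \<open>u = F(x,y)\<close>, \<open>(x,y) \<in> U\<close>, has the property \<open>P\<close> locally at its point over \<open>p\<close>.\<close>

definition locally_at ::
  "((real ^ 3) set \<Rightarrow> bool) \<Rightarrow> (real \<Rightarrow> real \<Rightarrow> real) \<Rightarrow> (real \<times> real) set \<Rightarrow> real \<times> real \<Rightarrow> bool" where
  "locally_at P F U p \<longleftrightarrow> (\<exists>V. open V \<and> p \<in> V \<and> V \<subseteq> U \<and> P (graph_over F V))"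

end

theory Submission
  imports Defs
begin

text \<open>The kernel of the Hessian of \<open>F\<close> is spanned by \<open>(m, 1)\<close> with \<open>m = - F\<^sub>x\<^sub>y / F\<^sub>x\<^sub>x\<close>, and the vanishing
  of the Hessian determinant turns into Burgers' equation \<open>m\<^sub>y + m m\<^sub>x = 0\<close>. Hence \<open>m\<close> is constant
  along its characteristics; these are projections of lines in the surface, and every line in
  the surface arises in this way. One computes \<open>S = - m\<^sub>x\<close>, and \<open>W\<close> equals \<open>- m\<^sub>x\<^sub>x\<close> up to
  a nowhere vanishing factor. So the rulers are parallel iff \<open>m\<^sub>x = 0\<close>. Otherwise, on the slice
  \<open>y = b\<close>, infinitely near rulers meet at the parameter \<open>- 1 / m\<^sub>x\<close> along \<open>(m, 1)\<close>. The
  locus of these meeting points is a single point if \<open>m\<^sub>x\<^sub>x = 0\<close> and, if \<open>m\<^sub>x\<^sub>x \<noteq> 0\<close>, a regular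
  curve to which the rulers are tangent.\<close>

subsection \<open>Double power series\<close>

text \<open>The slope \<open>k\<close> of the ruler is what lifts the planar picture to space: its
  gradient is \<open>Dx F\<close> times the gradient of \<open>m\<close>, so \<open>k\<close> is
  constant along the same characteristics. On a slice \<open>y = b\<close> this makes the
  derivatives of the foot point \<open>base\<close> and of the direction \<open>dir\<close>
  parallel: they are \<open>tang\<close> and \<open>mx * tang\<close>. Hence every curve
  \<open>base + \<sigma> *\<^sub>R dir\<close> has velocity
  \<open>(1 + \<sigma> * mx) *\<^sub>R tang + \<sigma>' *\<^sub>R dir\<close>. Developability is
  immediate from this, and \<open>\<sigma> = - 1 / mx\<close> is the choice that leaves only a
  multiple of \<open>dir\<close>. In the other direction the ruling is arbitrary, so its direction
  has to be recognized as the kernel direction, and information on \<open>mx\<close> and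
  \<open>mxx\<close> is obtained at the point \<open>p\<close> alone. The dichotomies for the two
  invariants spread it over \<open>U\<close>. Analyticity of the constructed curves is part of the
  claim; this is why power series are followed from \<open>F\<close> through derivatives and
  quotients down to functions of one variable.\<close>

definition expands2 ::
  "(nat \<Rightarrow> nat \<Rightarrow> real) \<Rightarrow> (real \<Rightarrow> real \<Rightarrow> real) \<Rightarrow> real \<Rightarrow> real \<Rightarrow> real \<Rightarrow> bool" where
  "expands2 c f a b r \<longleftrightarrow> (\<forall>x y. \<bar>x - a\<bar> < r \<longrightarrow> \<bar>y - b\<bar> < r \<longrightarrow>
     ((\<lambda>(i, j). c i j * (x - a) ^ i * (y - b) ^ j) has_sum f x y) UNIV)"

lemma real_analytic2_on_expands2:
  "real_analytic2_on F U \<longleftrightarrow> (\<forall>(a, b)\<in>U. \<exists>r>0. \<exists>c. expands2 c F a b r)"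
  unfolding real_analytic2_on_def expands2_def ..

lemma expands2D:
  assumes "expands2 c f a b r" "\<bar>x - a\<bar> < r" "\<bar>y - b\<bar> < r"
  shows "((\<lambda>(i, j). c i j * (x - a) ^ i * (y - b) ^ j) has_sum f x y) UNIV"
  using assms unfolding expands2_def by blast

lemma expands2_swap:
  assumes "expands2 c f a b r"
  shows "expands2 (\<lambda>i j. c j i) (\<lambda>x y. f y x) b a r"
  unfolding expands2_def
proof (intro allI impI)
  fix x y assume "\<bar>x - b\<bar> < r" "\<bar>y - a\<bar> < r"
  then have "((\<lambda>(i, j). c i j * (y - a) ^ i * (x - b) ^ j) has_sum f y x) UNIV"
    using expands2D[OF assms] by blast
  then have "(((\<lambda>(i, j). c i j * (y - a) ^ i * (x - b) ^ j) \<circ> prod.swap) has_sum f y x) UNIV"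
    by (subst has_sum_reindex[symmetric]) auto
  then show "((\<lambda>(i, j). c j i * (x - b) ^ i * (y - a) ^ j) has_sum f y x) UNIV"
    by (simp add: o_def case_prod_unfold prod.swap_def mult_ac)
qed

lemma expands2_unique_value:
  assumes "expands2 c f a b r" "expands2 c g a b r" "\<bar>x - a\<bar> < r" "\<bar>y - b\<bar> < r"
  shows "f x y = g x y"
  using expands2D[OF assms(1,3,4)] expands2D[OF assms(2,3,4)] by (rule has_sum_unique)

text \<open>Serves termwise differentiation: the factor \<open>Suc n\<close> is absorbed by passing
  to a slightly larger radius, \<open>q\<close> being the ratio of the two radii.\<close>

lemma power_times_Suc_bounded:
  fixes q :: real
  assumes "\<bar>q\<bar> < 1"
  obtains C where "\<And>n. real (Suc n) * \<bar>q\<bar> ^ n \<le> C"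
proof -
  have "(\<lambda>n. of_nat n * \<bar>q\<bar> ^ n) \<longlonglongrightarrow> 0"
    using assms by (intro powser_times_n_limit_0) auto
  then have "Bseq (\<lambda>n. of_nat n * \<bar>q\<bar> ^ n)"
    by (intro convergent_imp_Bseq convergentI)
  then obtain K where K: "\<And>n. norm (of_nat n * \<bar>q\<bar> ^ n) \<le> K"
    by (auto simp: Bseq_def)
  have "real (Suc n) * \<bar>q\<bar> ^ n \<le> K + 1" for n
    using K[of n] power_le_one[of "\<bar>q\<bar>" n] assms by (simp add: algebra_simps)
  then show ?thesis using that by blast
qed

text \<open>Unconditional summation allows summing over \<open>j\<close> first. The inner sums do
  not depend on \<open>z\<close>, so they are the coefficients of an ordinary power series on the
  slice.\<close>

lemma expands2_slice:
  assumes E: "expands2 c f a b r" and r: "r > 0" and y: "\<bar>y - b\<bar> < r"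
  obtains g where "\<And>i. ((\<lambda>j. c i j * (y - b) ^ j) has_sum g i) UNIV"
    and "\<And>z. \<bar>z\<bar> < r \<Longrightarrow> (\<lambda>i. g i * z ^ i) sums f (a + z) y"
proof -
  define v where "v = y - b"
  have S: "((\<lambda>(i, j). c i j * z ^ i * v ^ j) has_sum f (a + z) y) (UNIV \<times> UNIV)" if "\<bar>z\<bar> < r" for z
    using expands2D[OF E, of "a + z" y] that y by (simp add: v_def)
  \<comment> \<open>Any radius strictly between 0 and \<open>r\<close> serves: being nonzero, its
    powers can be divided out to make each row summable by itself.\<close>
  define \<rho> where "\<rho> = r / 2"
  have \<rho>: "\<rho> > 0" "\<rho> < r" using r by (auto simp: \<rho>_def)
  have summ: "(\<lambda>(i, j). c i j * \<rho> ^ i * v ^ j) summable_on (UNIV \<times> UNIV)"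
    using S[of \<rho>] \<rho> unfolding summable_on_def by auto
  have inner: "(\<lambda>j. c i j * v ^ j) summable_on UNIV" for i
  proof -
    have "(\<lambda>j. c i j * \<rho> ^ i * v ^ j) summable_on UNIV"
      using summable_on_SigmaD1[OF summ, of i] by simp
    then have "(\<lambda>j. (1 / \<rho> ^ i) * (c i j * \<rho> ^ i * v ^ j)) summable_on UNIV"
      by (rule summable_on_cmult_right)
    then show ?thesis using \<rho> by simp
  qed
  define g where "g i = (\<Sum>\<^sub>\<infinity>j. c i j * v ^ j)" for i
  have g: "((\<lambda>j. c i j * v ^ j) has_sum g i) UNIV" for i
    unfolding g_def using inner by (rule has_sum_infsum)
  have gs: "(\<lambda>i. g i * z ^ i) sums f (a + z) y" if "\<bar>z\<bar> < r" for z
  proof (rule has_sum_imp_sums, rule has_sum_SigmaD[OF S[OF that]])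
    fix i show "((\<lambda>j. case (i, j) of (i, j) \<Rightarrow> c i j * z ^ i * v ^ j) has_sum g i * z ^ i) UNIV"
      using has_sum_cmult_left[OF g[of i], of "z ^ i"] by (simp add: mult_ac)
  qed
  show ?thesis using that g gs unfolding v_def by blast
qed

text \<open>On the slice with fixed \<open>y\<close>, termwise differentiation in one variable gives
  the derivative. The differentiated double series is absolutely summable by comparison with the
  original one at some \<open>\<rho>\<close> between \<open>\<bar>u\<bar>\<close> and
  \<open>r\<close>; summing it row by row identifies its value. The radius does not shrink.\<close>

lemma expands2_partial:
  assumes E: "expands2 c f a b r" and x: "\<bar>x - a\<bar> < r" and y: "\<bar>y - b\<bar> < r"
  shows "((\<lambda>(i, j). (real (Suc i) * c (Suc i) j) * (x - a) ^ i * (y - b) ^ j)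
            has_sum Dx f x y) UNIV"
    and "((\<lambda>s. f s y) has_real_derivative Dx f x y) (at x)"
proof -
  define u v where "u = x - a" and "v = y - b"
  have u: "\<bar>u\<bar> < r" and v: "\<bar>v\<bar> < r" using x y by (auto simp: u_def v_def)
  obtain \<rho> where \<rho>: "\<bar>u\<bar> < \<rho>" "\<rho> < r" using dense[OF u] by blast
  have \<rho>0: "\<rho> > 0" using \<rho> by auto
  have summ: "(\<lambda>(i, j). c i j * \<rho> ^ i * v ^ j) summable_on (UNIV \<times> UNIV)"
    using expands2D[OF E, of "a + \<rho>" y] \<rho> \<rho>0 y unfolding summable_on_def v_def by auto
  obtain g where g: "\<And>i. ((\<lambda>j. c i j * v ^ j) has_sum g i) UNIV"
    and gs: "\<And>z. \<bar>z\<bar> < r \<Longrightarrow> (\<lambda>i. g i * z ^ i) sums f (a + z) y"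
    using expands2_slice[OF E _ y] \<rho> \<rho>0 unfolding v_def by auto
  have "((\<lambda>z. \<Sum>n. g n * z ^ n) has_field_derivative (\<Sum>n. diffs g n * u ^ n)) (at u)"
    using gs u by (intro termdiffs_strong'[where K = r]) (auto simp: sums_iff)
  then have "((\<lambda>z. f (a + z) y) has_field_derivative (\<Sum>n. diffs g n * u ^ n)) (at u)"
  proof (rule has_field_derivative_transform_within_open)
    show "open {z. \<bar>z\<bar> < r}" by (intro open_Collect_less continuous_intros)
  qed (use u gs in \<open>auto simp: sums_iff\<close>)
  then have der: "((\<lambda>s. f s y) has_field_derivative (\<Sum>n. diffs g n * u ^ n)) (at x)"
    using DERIV_shift[of "\<lambda>s. f s y" _ u a] by (simp add: u_def add.commute)
  then have Dx: "Dx f x y = (\<Sum>n. diffs g n * u ^ n)"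
    unfolding Dx_def by (rule DERIV_imp_deriv)
  show "((\<lambda>s. f s y) has_real_derivative Dx f x y) (at x)"
    using der Dx by simp
  obtain C where C: "\<And>n. real (Suc n) * \<bar>u / \<rho>\<bar> ^ n \<le> C"
    using power_times_Suc_bounded[of "u / \<rho>"] \<rho> by auto
  have "(\<lambda>(i, j). c i j * \<rho> ^ i * v ^ j) summable_on (\<lambda>(i, j). (Suc i, j)) ` (UNIV \<times> UNIV)"
    using summ by (rule summable_on_subset_banach) auto
  then have "((\<lambda>(i, j). c i j * \<rho> ^ i * v ^ j) \<circ> (\<lambda>(i, j). (Suc i, j))) summable_on (UNIV \<times> UNIV)"
    by (subst summable_on_reindex[symmetric]) (auto simp: inj_on_def)
  then have s1: "(\<lambda>(i, j). c (Suc i) j * \<rho> ^ Suc i * v ^ j) summable_on (UNIV \<times> UNIV)"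
    by (simp add: o_def case_prod_unfold)
  define d where "d p = (case p of (i, j) \<Rightarrow> (real (Suc i) * c (Suc i) j) * u ^ i * v ^ j)" for p
  \<comment> \<open>The majorant: the original series at \<open>(\<rho>, v)\<close>, shifted by one
    row. The division by \<open>\<rho>\<close> compensates for the exponent \<open>Suc i\<close> in
    place of \<open>i\<close>.\<close>
  define e where "e p = (case p of (i, j) \<Rightarrow> (C / \<rho>) * (c (Suc i) j * \<rho> ^ Suc i * v ^ j))" for p
  have "e summable_on (UNIV \<times> UNIV)"
    using summable_on_cmult_right[OF s1, of "C / \<rho>"]
    unfolding e_def[abs_def] by (rule summable_on_cong[THEN iffD1, rotated]) auto
  then have s2: "(\<lambda>p. norm (e p)) summable_on (UNIV \<times> UNIV)"
    by (rule summable_on_iff_abs_summable_on_real[THEN iffD1])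
  have "(\<lambda>p. norm (d p)) summable_on (UNIV \<times> UNIV)"
  proof (rule Infinite_Sum.abs_summable_on_comparison_test[OF s2])
    fix p :: "nat \<times> nat"
    obtain i j where [simp]: "p = (i, j)" by (cases p)
    have "\<bar>u\<bar> ^ i = \<bar>u / \<rho>\<bar> ^ i * \<rho> ^ i" using \<rho>0 by (simp add: power_divide)
    then have "real (Suc i) * \<bar>u\<bar> ^ i \<le> C * \<rho> ^ i"
      using mult_right_mono[OF C[of i], of "\<rho> ^ i"] \<rho>0 by (simp add: mult_ac)
    also have "\<dots> \<le> \<bar>C\<bar> * \<rho> ^ i"
      using \<rho>0 by (intro mult_right_mono) auto
    finally have "\<bar>c (Suc i) j\<bar> * \<bar>v\<bar> ^ j * (real (Suc i) * \<bar>u\<bar> ^ i)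
        \<le> \<bar>c (Suc i) j\<bar> * \<bar>v\<bar> ^ j * (\<bar>C\<bar> * \<rho> ^ i)"
      by (intro mult_left_mono) auto
    moreover have "norm (d p) = \<bar>c (Suc i) j\<bar> * \<bar>v\<bar> ^ j * (real (Suc i) * \<bar>u\<bar> ^ i)"
      by (simp add: d_def abs_mult power_abs)
    moreover have "norm (e p) = \<bar>c (Suc i) j\<bar> * \<bar>v\<bar> ^ j * (\<bar>C\<bar> * \<rho> ^ i)"
      using \<rho>0 by (simp add: e_def abs_mult power_abs)
    ultimately show "norm (d p) \<le> norm (e p)" by simp
  qed
  then have "d summable_on (UNIV \<times> UNIV)"
    by (rule summable_on_iff_abs_summable_on_real[THEN iffD2])
  then have "(\<lambda>(i, j). (real (Suc i) * c (Suc i) j) * u ^ i * v ^ j) summable_on (UNIV \<times> UNIV)"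
    by (simp add: d_def[abs_def])
  then obtain S' where S': "((\<lambda>(i, j). (real (Suc i) * c (Suc i) j) * u ^ i * v ^ j) has_sum S')
      (UNIV \<times> UNIV)"
    unfolding summable_on_def by blast
  have "(\<lambda>i. diffs g i * u ^ i) sums S'"
  proof (rule has_sum_imp_sums, rule has_sum_SigmaD[OF S'])
    fix i show "((\<lambda>j. case (i, j) of (i, j) \<Rightarrow> real (Suc i) * c (Suc i) j * u ^ i * v ^ j)
        has_sum diffs g i * u ^ i) UNIV"
      using has_sum_cmult_left[OF g[of "Suc i"], of "real (Suc i) * u ^ i"]
      by (simp add: diffs_def mult_ac)
  qed
  then have "S' = Dx f x y" using Dx by (simp add: sums_iff)
  then show "((\<lambda>(i, j). (real (Suc i) * c (Suc i) j) * (x - a) ^ i * (y - b) ^ j)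
            has_sum Dx f x y) UNIV"
    using S' by (simp add: u_def v_def)
qed

lemma expands2_Dx:
  assumes "expands2 c f a b r"
  shows "expands2 (\<lambda>i j. real (Suc i) * c (Suc i) j) (Dx f) a b r"
  using expands2_partial(1)[OF assms] unfolding expands2_def by blast

lemma Dy_eq_Dx_swap: "Dy f = (\<lambda>x y. Dx (\<lambda>y x. f x y) y x)"
  by (simp add: fun_eq_iff Dx_def Dy_def)

lemma expands2_Dy:
  assumes "expands2 c f a b r"
  shows "expands2 (\<lambda>i j. real (Suc j) * c i (Suc j)) (Dy f) a b r"
  using expands2_swap[OF expands2_Dx[OF expands2_swap[OF assms]]] by (simp add: Dy_eq_Dx_swap)

lemma real_analytic2_on_Dx:
  assumes "real_analytic2_on f U"
  shows "real_analytic2_on (Dx f) U"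
  unfolding real_analytic2_on_expands2
proof safe
  fix a b assume "(a, b) \<in> U"
  then obtain r c where "r > 0" "expands2 c f a b r"
    using assms unfolding real_analytic2_on_expands2 by blast
  then show "\<exists>r>0. \<exists>c. expands2 c (Dx f) a b r"
    using expands2_Dx by blast
qed

lemma real_analytic2_on_Dy:
  assumes "real_analytic2_on f U"
  shows "real_analytic2_on (Dy f) U"
  unfolding real_analytic2_on_expands2
proof safe
  fix a b assume "(a, b) \<in> U"
  then obtain r c where "r > 0" "expands2 c f a b r"
    using assms unfolding real_analytic2_on_expands2 by blast
  then show "\<exists>r>0. \<exists>c. expands2 c (Dy f) a b r"
    using expands2_Dy by blast
qed

text \<open>Both mixed derivatives are expanded by the same coefficients around the point.\<close>

lemma Dx_Dy_commute:
  assumes "real_analytic2_on f U" "(x, y) \<in> U"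
  shows "Dx (Dy f) x y = Dy (Dx f) x y"
proof -
  obtain r c where r: "r > 0" "expands2 c f x y r"
    using assms unfolding real_analytic2_on_expands2 by blast
  have "expands2 (\<lambda>i j. real (Suc i) * (real (Suc j) * c (Suc i) (Suc j))) (Dx (Dy f)) x y r"
    using expands2_Dx[OF expands2_Dy[OF r(2)]] .
  moreover have "expands2 (\<lambda>i j. real (Suc i) * (real (Suc j) * c (Suc i) (Suc j))) (Dy (Dx f)) x y r"
    using expands2_Dy[OF expands2_Dx[OF r(2)]] by (simp add: mult.left_commute)
  ultimately show ?thesis using r(1) by (intro expands2_unique_value) auto
qed

text \<open>Weierstrass M-test on the closed square of half side \<open>r/2\<close>: each term is
  largest in absolute value at the corner, where the series is absolutely summable.\<close>

lemma expands2_continuous: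
  assumes E: "expands2 c f a b r" and r: "r > 0"
  shows "continuous (at (a, b)) (\<lambda>(x, y). f x y)"
proof -
  define Y where "Y = {a - r/2..a + r/2} \<times> {b - r/2..b + r/2}"
  let ?t = "\<lambda>(i, j) (x, y). c i j * (x - a) ^ i * (y - b) ^ j"
  have "((\<lambda>(i, j). c i j * (r/2) ^ i * (r/2) ^ j) has_sum f (a + r/2) (b + r/2)) UNIV"
    using expands2D[OF E, of "a + r/2" "b + r/2"] r by simp
  then have "(\<lambda>(i, j). c i j * (r/2) ^ i * (r/2) ^ j) summable_on UNIV"
    unfolding summable_on_def by blast
  then have M: "(\<lambda>p. norm ((\<lambda>(i, j). c i j * (r/2) ^ i * (r/2) ^ j) p)) summable_on UNIV"
    by (rule summable_on_iff_abs_summable_on_real[THEN iffD1])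
  have "uniform_limit Y (\<lambda>X y. \<Sum>x\<in>X. ?t x y) (\<lambda>(x, y). f x y) (finite_subsets_at_top UNIV)"
  proof (rule Weierstrass_m_test_general'[OF _ _ M])
    fix p :: "nat \<times> nat" and z assume z: "z \<in> Y"
    obtain i j x y where [simp]: "p = (i, j)" "z = (x, y)" by (cases p, cases z) auto
    have "\<bar>x - a\<bar> \<le> r/2" "\<bar>y - b\<bar> \<le> r/2"
      using z unfolding Y_def abs_le_iff by (auto simp: algebra_simps)
    then have "\<bar>x - a\<bar> ^ i \<le> (r/2) ^ i" "\<bar>y - b\<bar> ^ j \<le> (r/2) ^ j"
      by (auto intro!: power_mono)
    then show "norm (?t p z) \<le> norm ((\<lambda>(i, j). c i j * (r/2) ^ i * (r/2) ^ j) p)"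
      using r by (auto simp: abs_mult power_abs intro!: mult_mono)
  next
    fix z assume "z \<in> Y"
    then show "((\<lambda>p. ?t p z) has_sum (case z of (x, y) \<Rightarrow> f x y)) UNIV"
      using expands2D[OF E, of "fst z" "snd z"] r
      by (auto simp: Y_def case_prod_unfold abs_if)
  qed
  then have "continuous_on Y (\<lambda>(x, y). f x y)"
    by (rule uniform_limit_theorem[rotated])
      (auto intro!: always_eventually continuous_intros simp: case_prod_unfold)
  moreover have "(a, b) \<in> interior Y"
    using r by (simp add: Y_def interior_Times)
  ultimately show ?thesis by (rule continuous_on_interior)
qed

text \<open>It suffices to have one partial derivative at the point and the other one near it,
  continuous at the point. Continuity of \<open>Dy f\<close> comes from its own expansion.\<close>

lemma real_analytic2_on_has_derivative:
  assumes f: "real_analytic2_on f U" and U: "open U" and p: "(x, y) \<in> U"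
  shows "((\<lambda>z. f (fst z) (snd z)) has_derivative (\<lambda>h. Dx f x y * fst h + Dy f x y * snd h))
           (at (x, y))"
proof -
  obtain r c where r: "r > 0" "expands2 c f x y r"
    using f p unfolding real_analytic2_on_expands2 by blast
  define X Y where "X = ball x r" and "Y = ball y r"
  have fx: "((\<lambda>s. f s y) has_derivative (*) (Dx f x y)) (at x within X)"
    using expands2_partial(2)[OF r(2), of x y] r(1)
    by (simp add: has_field_derivative_def has_derivative_at_withinI)
  have fy: "((\<lambda>t. f s t) has_derivative blinfun_scaleR_right (Dy f s t)) (at t within Y)"
    if "s \<in> X" "t \<in> Y" for s t
    using expands2_partial(2)[OF expands2_swap[OF r(2)], of t s] that
    by (simp add: X_def Y_def dist_real_def abs_minus_commute has_field_derivative_def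
        has_derivative_at_withinI Dy_eq_Dx_swap real_scaleR_def[abs_def] mult.commute)
  have "continuous (at (x, y)) (\<lambda>(s, t). blinfun_scaleR_right (Dy f s t))"
    using bounded_linear.continuous[OF bounded_linear_blinfun_scaleR_right
        expands2_continuous[OF expands2_Dy[OF r(2)] r(1)]]
    by (simp add: case_prod_unfold)
  then have cont: "continuous (at (x, y) within X \<times> Y) (\<lambda>(s, t). blinfun_scaleR_right (Dy f s t))"
    by (rule continuous_at_imp_continuous_at_within)
  have "((\<lambda>(x, y). f x y) has_derivative
      (\<lambda>(tx, ty). Dx f x y * tx + blinfun_scaleR_right (Dy f x y) ty)) (at (x, y) within X \<times> Y)"
    by (rule has_derivative_partialsI[OF fx fy cont]) (use r in \<open>auto simp: Y_def\<close>)
  moreover have "at (x, y) within X \<times> Y = at (x, y)"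
    using r by (intro at_within_open) (auto simp: X_def Y_def open_Times)
  ultimately show ?thesis by (simp add: case_prod_unfold mult.commute)
qed

subsection \<open>Analytic functions of one real variable\<close>

text \<open>Formal power series are the chosen encoding because \<open>has_fps_expansion\<close> is
  preserved by products, inverses and derivatives; \<open>analytic_at1_sums\<close> translates to
  and from convergent sums.\<close>

definition analytic_at1 :: "(real \<Rightarrow> real) \<Rightarrow> real \<Rightarrow> bool" where
  "analytic_at1 f a \<longleftrightarrow> (\<exists>G. (\<lambda>x. f (a + x)) has_fps_expansion G)"

lemma analytic_at1_cong:
  assumes "eventually (\<lambda>t. f t = g t) (nhds a)"
  shows "analytic_at1 f a \<longleftrightarrow> analytic_at1 g a"
proof -
  have *: "analytic_at1 v a" if u: "analytic_at1 u a" and uv: "eventually (\<lambda>t. u t = v t) (nhds a)" for u v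
  proof -
    obtain G where G: "fps_conv_radius G > 0" "eventually (\<lambda>x. eval_fps G x = u (a + x)) (nhds 0)"
      using u unfolding analytic_at1_def has_fps_expansion_def by blast
    have lim: "filterlim (\<lambda>x. a + x) (nhds a) (nhds 0)"
      using tendsto_add[OF tendsto_const filterlim_ident, of a 0] by simp
    have "eventually (\<lambda>x. u (a + x) = v (a + x)) (nhds 0)"
      using eventually_compose_filterlim[OF uv lim] .
    with G(2) have "eventually (\<lambda>x. eval_fps G x = v (a + x)) (nhds 0)"
      by eventually_elim simp
    then show ?thesis using G(1) unfolding analytic_at1_def has_fps_expansion_def by blast
  qed
  show ?thesis using *[of f g] *[of g f] assms by (auto simp: eq_commute)
qed

lemma analytic_at1_const: "analytic_at1 (\<lambda>t. k) a"
  unfolding analytic_at1_def by blast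

lemma analytic_at1_id: "analytic_at1 (\<lambda>t. t) a"
  unfolding analytic_at1_def
  by (rule exI[of _ "fps_const a + fps_X"]) (intro fps_expansion_intros)

lemma analytic_at1_minus: "analytic_at1 f a \<Longrightarrow> analytic_at1 (\<lambda>t. - f t) a"
  unfolding analytic_at1_def using has_fps_expansion_minus by blast

lemma analytic_at1_add:
  "analytic_at1 f a \<Longrightarrow> analytic_at1 g a \<Longrightarrow> analytic_at1 (\<lambda>t. f t + g t) a"
  unfolding analytic_at1_def using has_fps_expansion_add by blast

lemma analytic_at1_mult:
  "analytic_at1 f a \<Longrightarrow> analytic_at1 g a \<Longrightarrow> analytic_at1 (\<lambda>t. f t * g t) a"
  unfolding analytic_at1_def using has_fps_expansion_mult by blast

lemma analytic_at1_divide: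
  assumes "analytic_at1 f a" "analytic_at1 g a" "g a \<noteq> 0"
  shows "analytic_at1 (\<lambda>t. f t / g t) a"
proof -
  obtain G where G: "(\<lambda>x. g (a + x)) has_fps_expansion G"
    using assms(2) unfolding analytic_at1_def by blast
  have "fps_nth G 0 = g a"
    using G eventually_nhds_x_imp_x unfolding has_fps_expansion_def by (fastforce simp: eval_fps_at_0)
  then have "analytic_at1 (\<lambda>t. inverse (g t)) a"
    using has_fps_expansion_inverse[OF G] assms(3) unfolding analytic_at1_def by auto
  then show ?thesis using analytic_at1_mult[OF assms(1)] by (simp add: divide_inverse)
qed

lemma analytic_at1_sums:
  "analytic_at1 f a \<longleftrightarrow> (\<exists>r>0. \<exists>c. \<forall>t. \<bar>t - a\<bar> < r \<longrightarrow> (\<lambda>n. c n * (t - a) ^ n) sums f t)"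
proof
  assume "analytic_at1 f a"
  then obtain G where G: "fps_conv_radius G > 0" "eventually (\<lambda>x. eval_fps G x = f (a + x)) (nhds 0)"
    unfolding analytic_at1_def has_fps_expansion_def by blast
  have "eventually (\<lambda>x. x \<in> eball 0 (fps_conv_radius G)) (nhds 0)"
    using G(1) by (intro eventually_nhds_in_open) (auto simp: zero_ereal_def)
  with G(2) have "eventually (\<lambda>x. (\<lambda>n. fps_nth G n * x ^ n) sums f (a + x)) (nhds 0)"
  proof eventually_elim
    case (elim x)
    then have "summable (\<lambda>n. fps_nth G n * x ^ n)"
      by (intro summable_fps) auto
    then show ?case using elim unfolding eval_fps_def by (simp add: sums_iff)
  qed
  then obtain r where "r > 0" "\<And>x. dist x 0 < r \<Longrightarrow> (\<lambda>n. fps_nth G n * x ^ n) sums f (a + x)"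
    unfolding eventually_nhds_metric by blast
  from this(1) this(2)[of "t - a" for t]
  show "\<exists>r>0. \<exists>c. \<forall>t. \<bar>t - a\<bar> < r \<longrightarrow> (\<lambda>n. c n * (t - a) ^ n) sums f t"
    by (intro exI[of _ r] conjI exI[of _ "fps_nth G"]) auto
next
  assume "\<exists>r>0. \<exists>c. \<forall>t. \<bar>t - a\<bar> < r \<longrightarrow> (\<lambda>n. c n * (t - a) ^ n) sums f t"
  then obtain r c where r: "r > 0" "\<And>t. \<bar>t - a\<bar> < r \<Longrightarrow> (\<lambda>n. c n * (t - a) ^ n) sums f t"
    by blast
  have "(\<lambda>x. f (a + x)) has_fps_expansion Abs_fps c"
  proof (rule has_fps_expansionI)
    show "eventually (\<lambda>x. (\<lambda>n. fps_nth (Abs_fps c) n * x ^ n) sums f (a + x)) (nhds 0)"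
      unfolding eventually_nhds_metric using r(1) r(2)[of "a + x" for x]
      by (intro exI[of _ r]) auto
  qed
  then show "analytic_at1 f a" unfolding analytic_at1_def by blast
qed

lemma analytic_at1_deriv: "analytic_at1 f a \<Longrightarrow> analytic_at1 (deriv f) a"
proof -
  assume "analytic_at1 f a"
  then obtain G where "(\<lambda>x. f (a + x)) has_fps_expansion G" unfolding analytic_at1_def by blast
  then have "deriv (\<lambda>x. f (a + x)) has_fps_expansion fps_deriv G"
    by (rule has_fps_expansion_deriv)
  moreover have "deriv (\<lambda>x. f (a + x)) = (\<lambda>x. deriv f (a + x))"
    by (simp add: fun_eq_iff deriv_def DERIV_shift add.commute)
  ultimately show ?thesis unfolding analytic_at1_def by auto
qed

lemma analytic_at1_has_derivative:
  assumes "analytic_at1 f a"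
  shows "(f has_real_derivative deriv f a) (at a)"
proof -
  obtain r c where r: "r > 0" "\<And>t. \<bar>t - a\<bar> < r \<Longrightarrow> (\<lambda>n. c n * (t - a) ^ n) sums f t"
    using assms unfolding analytic_at1_sums by blast
  have s: "(\<lambda>n. c n * z ^ n) sums f (a + z)" if "\<bar>z\<bar> < r" for z
    using r(2)[of "a + z"] that by simp
  have "((\<lambda>z. \<Sum>n. c n * z ^ n) has_field_derivative (\<Sum>n. diffs c n * 0 ^ n)) (at 0)"
    using s r(1) by (intro termdiffs_strong'[where K = r]) (auto simp: sums_iff)
  then have "((\<lambda>z. f (a + z)) has_field_derivative (\<Sum>n. diffs c n * 0 ^ n)) (at 0)"
  proof (rule has_field_derivative_transform_within_open)
    show "open {z. \<bar>z\<bar> < r}" by (intro open_Collect_less continuous_intros)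
  qed (use r(1) s in \<open>auto simp: sums_iff\<close>)
  then have "(f has_field_derivative (\<Sum>n. diffs c n * 0 ^ n)) (at a)"
    using DERIV_shift[of f _ 0 a] by (simp add: add.commute)
  then show ?thesis using DERIV_imp_deriv[of f] by simp
qed

lemma real_analytic2_on_slice:
  assumes "real_analytic2_on f U" "(a, b) \<in> U"
  shows "analytic_at1 (\<lambda>s. f s b) a"
proof -
  obtain r c where r: "r > 0" "expands2 c f a b r"
    using assms unfolding real_analytic2_on_expands2 by blast
  obtain g where g: "\<And>z. \<bar>z\<bar> < r \<Longrightarrow> (\<lambda>i. g i * z ^ i) sums f (a + z) b"
    using expands2_slice[OF r(2,1), of b] r(1) by (metis abs_zero diff_self)
  show ?thesis unfolding analytic_at1_sums
    using r(1) g[of "t - a" for t] by (intro exI[of _ r] conjI exI[of _ g]) auto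
qed

section \<open>Analytic space curves and their velocities, by components\<close>

lemma real_analytic_curve_on_components:
  "real_analytic_curve_on \<gamma> I \<longleftrightarrow> (\<forall>a\<in>I. \<forall>i. analytic_at1 (\<lambda>t. \<gamma> t $ i) a)"
proof safe
  fix a i assume "real_analytic_curve_on \<gamma> I" "a \<in> I"
  then obtain r c where r: "r > 0" "\<And>t. \<bar>t - a\<bar> < r \<Longrightarrow> (\<lambda>n. (t - a) ^ n *\<^sub>R c n) sums \<gamma> t"
    unfolding real_analytic_curve_on_def by blast
  have "(\<lambda>n. c n $ i * (t - a) ^ n) sums (\<gamma> t $ i)" if "\<bar>t - a\<bar> < r" for t
    using bounded_linear.sums[OF bounded_linear_vec_nth r(2)[OF that], of i] by (simp add: mult.commute)
  then show "analytic_at1 (\<lambda>t. \<gamma> t $ i) a"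
    unfolding analytic_at1_sums using r(1) by (intro exI[of _ r] conjI exI[of _ "\<lambda>n. c n $ i"]) auto
next
  assume A: "\<forall>a\<in>I. \<forall>i. analytic_at1 (\<lambda>t. \<gamma> t $ i) a"
  show "real_analytic_curve_on \<gamma> I" unfolding real_analytic_curve_on_def
  proof
    fix a assume "a \<in> I"
    then have "\<forall>i. \<exists>r c. r > 0 \<and> (\<forall>t. \<bar>t - a\<bar> < r \<longrightarrow> (\<lambda>n. c n * (t - a) ^ n) sums (\<gamma> t $ i))"
      using A unfolding analytic_at1_sums by blast
    then obtain r c where r: "\<And>i. r i > 0"
      "\<And>i t. \<bar>t - a\<bar> < r i \<Longrightarrow> (\<lambda>n. c i n * (t - a) ^ n) sums (\<gamma> t $ i)"
      by metis
    define R where "R = Min (range r)"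
    have R: "R > 0" "R \<le> r i" for i using r(1) by (auto simp: R_def)
    have "(\<lambda>n. (t - a) ^ n *\<^sub>R (\<chi> i. c i n)) sums \<gamma> t" if "\<bar>t - a\<bar> < R" for t
      unfolding sums_def
    proof (rule vec_tendstoI)
      fix i
      show "(\<lambda>n. (\<Sum>n<n. (t - a) ^ n *\<^sub>R (\<chi> i. c i n)) $ i) \<longlonglongrightarrow> \<gamma> t $ i"
        using r(2)[of t i] that R(2)[of i] by (simp add: sums_def mult.commute)
    qed
    then show "\<exists>r>0. \<exists>c. \<forall>t. \<bar>t - a\<bar> < r \<longrightarrow> (\<lambda>n. (t - a) ^ n *\<^sub>R c n) sums \<gamma> t"
      using R(1) by (intro exI[of _ R] conjI exI[of _ "\<lambda>n. \<chi> i. c i n"]) auto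
  qed
qed

lemma has_vector_derivative_vec_nth_iff:
  fixes \<gamma> :: "real \<Rightarrow> real ^ 'n"
  shows "(\<gamma> has_vector_derivative D) (at t within S) \<longleftrightarrow> (\<forall>i. ((\<lambda>t. \<gamma> t $ i) has_real_derivative D $ i) (at t within S))"
proof
  assume "(\<gamma> has_vector_derivative D) (at t within S)"
  then show "\<forall>i. ((\<lambda>t. \<gamma> t $ i) has_real_derivative D $ i) (at t within S)"
    using bounded_linear.has_vector_derivative[OF bounded_linear_vec_nth]
    by (auto simp: has_real_derivative_iff_has_vector_derivative)
next
  assume "\<forall>i. ((\<lambda>t. \<gamma> t $ i) has_real_derivative D $ i) (at t within S)"
  then have "((\<lambda>t. \<gamma> t \<bullet> b) has_derivative (\<lambda>x. (x *\<^sub>R D) \<bullet> b)) (at t within S)" if "b \<in> Basis" for b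
    using that by (auto simp: Basis_vec_def inner_axis has_field_derivative_def mult.commute[of _ "D $ _"])
  then show "(\<gamma> has_vector_derivative D) (at t within S)"
    unfolding has_vector_derivative_def by (subst has_derivative_componentwise_within) blast
qed

lemma real_analytic_curve_on_velocity_nth:
  assumes "real_analytic_curve_on \<gamma> I" "t \<in> I"
  shows "((\<lambda>s. \<gamma> s $ i) has_real_derivative velocity \<gamma> t $ i) (at t)"
proof -
  have "\<forall>i. ((\<lambda>t. \<gamma> t $ i) has_real_derivative (\<chi> i. deriv (\<lambda>t. \<gamma> t $ i) t) $ i) (at t)"
    using assms analytic_at1_has_derivative unfolding real_analytic_curve_on_components by simp
  then have "(\<gamma> has_vector_derivative (\<chi> i. deriv (\<lambda>t. \<gamma> t $ i) t)) (at t)"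
    unfolding has_vector_derivative_vec_nth_iff .
  then have "(\<gamma> has_vector_derivative velocity \<gamma> t) (at t)"
    using vector_derivative_at by fastforce
  then show ?thesis unfolding has_vector_derivative_vec_nth_iff by blast
qed

subsection \<open>Gradients and the characteristics of a parabolic graph\<close>

text \<open>Total differentiability with the partial derivatives as explicit numbers. Unlike
  \<open>Dx\<close> and \<open>Dy\<close> it supports the chain rule along curves, and uniqueness
  turns two computations of one gradient into an identity.\<close>

definition has_grad :: "(real \<Rightarrow> real \<Rightarrow> real) \<Rightarrow> real \<Rightarrow> real \<Rightarrow> real \<Rightarrow> real \<Rightarrow> bool" where
  "has_grad g p q x y \<longleftrightarrow>
     ((\<lambda>z. g (fst z) (snd z)) has_derivative (\<lambda>h. p * fst h + q * snd h)) (at (x, y))"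

lemma has_grad_const: "has_grad (\<lambda>x y. k) 0 0 x y"
  unfolding has_grad_def by simp

lemma has_grad_add:
  "has_grad f p q x y \<Longrightarrow> has_grad g p' q' x y \<Longrightarrow> has_grad (\<lambda>x y. f x y + g x y) (p + p') (q + q') x y"
  unfolding has_grad_def by (auto intro!: derivative_eq_intros simp: algebra_simps)

lemma has_grad_diff:
  "has_grad f p q x y \<Longrightarrow> has_grad g p' q' x y \<Longrightarrow> has_grad (\<lambda>x y. f x y - g x y) (p - p') (q - q') x y"
  unfolding has_grad_def by (auto intro!: derivative_eq_intros simp: algebra_simps)

lemma has_grad_minus: "has_grad f p q x y \<Longrightarrow> has_grad (\<lambda>x y. - f x y) (- p) (- q) x y"
  unfolding has_grad_def by (auto intro!: derivative_eq_intros simp: algebra_simps)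

lemma has_grad_mult:
  "has_grad f p q x y \<Longrightarrow> has_grad g p' q' x y \<Longrightarrow>
   has_grad (\<lambda>x y. f x y * g x y) (p * g x y + f x y * p') (q * g x y + f x y * q') x y"
  unfolding has_grad_def by (auto intro!: derivative_eq_intros simp: algebra_simps)

lemma has_grad_divide:
  assumes "has_grad f p q x y" "has_grad g p' q' x y" "g x y \<noteq> 0"
  shows "has_grad (\<lambda>x y. f x y / g x y) ((p * g x y - f x y * p') / (g x y)\<^sup>2)
           ((q * g x y - f x y * q') / (g x y)\<^sup>2) x y"
  using assms unfolding has_grad_def
  by (auto intro!: derivative_eq_intros simp: field_simps power2_eq_square)

lemma has_grad_unique:
  assumes "has_grad g p q x y" "has_grad g p' q' x y"
  shows "p = p'" "q = q'"
proof -
  have "(\<lambda>h. p * fst h + q * snd h) = (\<lambda>h. p' * fst h + q' * snd h)"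
    using assms unfolding has_grad_def by (rule has_derivative_unique)
  from fun_cong[OF this, of "(1, 0)"] fun_cong[OF this, of "(0, 1)"] show "p = p'" "q = q'" by auto
qed

lemma has_grad_cong_open:
  assumes "has_grad f p q x y" "open U" "(x, y) \<in> U" "\<And>x y. (x, y) \<in> U \<Longrightarrow> f x y = g x y"
  shows "has_grad g p q x y"
  using assms unfolding has_grad_def
  by (auto intro: has_derivative_transform_within_open[of _ _ _ UNIV U])

lemma has_grad_compose:
  assumes g: "has_grad g p q (X t) (Y t)"
    and X: "(X has_real_derivative X') (at t within S)"
    and Y: "(Y has_real_derivative Y') (at t within S)"
  shows "((\<lambda>t. g (X t) (Y t)) has_real_derivative p * X' + q * Y') (at t within S)"
proof -
  have "((\<lambda>t. (X t, Y t)) has_derivative (\<lambda>h. (X' * h, Y' * h))) (at t within S)"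
    using X Y unfolding has_field_derivative_def by (intro has_derivative_Pair)
  from has_derivative_compose[OF this] g
  have "((\<lambda>t. g (X t) (Y t)) has_derivative (\<lambda>h. p * (X' * h) + q * (Y' * h))) (at t within S)"
    unfolding has_grad_def by fastforce
  moreover have "(\<lambda>h. p * (X' * h) + q * (Y' * h)) = (*) (p * X' + q * Y')"
    by (simp add: algebra_simps fun_eq_iff)
  ultimately show ?thesis
    unfolding has_field_derivative_def by simp
qed

lemma has_grad_partial_x: "has_grad g p q x y \<Longrightarrow> ((\<lambda>s. g s y) has_real_derivative p) (at x)"
  using has_grad_compose[of g p q "\<lambda>s. s" x "\<lambda>s. y" 1 UNIV 0] by auto

lemma real_analytic2_on_has_grad:
  assumes "real_analytic2_on f U" "open U" "(x, y) \<in> U"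
  shows "has_grad f (Dx f x y) (Dy f x y) x y"
  using real_analytic2_on_has_derivative[OF assms] unfolding has_grad_def .

text \<open>Integrating factor: with \<open>G\<close> an antiderivative of \<open>c\<close>, the
  product \<open>z s * exp (- G s)\<close> has derivative zero.\<close>

lemma linear_ode_zero:
  fixes z c :: "real \<Rightarrow> real"
  assumes z: "\<And>s. s \<in> {a..b} \<Longrightarrow> (z has_real_derivative c s * z s) (at s within {a..b})"
    and c: "continuous_on {a..b} c"
    and s0: "s0 \<in> {a..b}" "z s0 = 0" and s: "s \<in> {a..b}"
  shows "z s = 0"
proof -
  obtain G where "\<And>s. s \<in> {a..b} \<Longrightarrow> (G has_vector_derivative c s) (at s within {a..b})"
    using antiderivative_continuous[OF c] by blast
  then have G: "\<And>s. s \<in> {a..b} \<Longrightarrow> (G has_real_derivative c s) (at s within {a..b})"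
    by (simp add: has_real_derivative_iff_has_vector_derivative)
  have "((\<lambda>s. z s * exp (- G s)) has_real_derivative 0) (at s within {a..b})" if "s \<in> {a..b}" for s
    by (rule derivative_eq_intros z[OF that] G[OF that] refl)+ (simp add: algebra_simps)
  then obtain k where "\<forall>s\<in>{a..b}. z s * exp (- G s) = k"
    using has_field_derivative_zero_constant[of "{a..b}" "\<lambda>s. z s * exp (- G s)"] by auto
  then have "z s * exp (- G s) = z s0 * exp (- G s0)" using s s0(1) by simp
  then show ?thesis using s0(2) by simp
qed

section \<open>Burgers' equation for the kernel slope and straightness of the
  characteristics\<close>

locale parabolic =
  fixes F :: "real \<Rightarrow> real \<Rightarrow> real" and U :: "(real \<times> real) set"
  assumes open_U: "open U" and analytic: "real_analytic2_on F U"
    and Fxx: "\<And>x y. (x, y) \<in> U \<Longrightarrow> Dx (Dx F) x y \<noteq> 0"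
    and hessian: "\<And>x y. (x, y) \<in> U \<Longrightarrow> Dx (Dx F) x y * Dy (Dy F) x y - (Dy (Dx F) x y)\<^sup>2 = 0"
begin

text \<open>The tangent direction of the graph over the kernel direction \<open>(m, 1)\<close> is \<open>(m, 1, k)\<close>. The
  functions \<open>mx\<close> and \<open>mxx\<close> are \<open>m\<^sub>x\<close> and \<open>m\<^sub>x\<^sub>x\<close>, expressed by the numerators of the two invariants.\<close>

definition m :: "real \<Rightarrow> real \<Rightarrow> real" where
  "m x y = - Dy (Dx F) x y / Dx (Dx F) x y"

definition k :: "real \<Rightarrow> real \<Rightarrow> real" where
  "k x y = Dy F x y + m x y * Dx F x y"

definition mx :: "real \<Rightarrow> real \<Rightarrow> real" where
  "mx x y = (Dy (Dx F) x y * Dx (Dx (Dx F)) x y - Dx (Dx F) x y * Dy (Dx (Dx F)) x y) / (Dx (Dx F) x y)\<^sup>2"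

definition mxx :: "real \<Rightarrow> real \<Rightarrow> real" where
  "mxx x y = - (Dx (Dx F) x y ^ 2 * Dy (Dx (Dx (Dx F))) x y
      - Dx (Dx F) x y * Dy (Dx F) x y * Dx (Dx (Dx (Dx F))) x y
      + 2 * Dy (Dx F) x y * Dx (Dx (Dx F)) x y ^ 2
      - 2 * Dx (Dx F) x y * Dx (Dx (Dx F)) x y * Dy (Dx (Dx F)) x y) / Dx (Dx F) x y ^ 3"

lemmas has_gradI = real_analytic2_on_has_grad[OF _ open_U]
lemmas analytic_intros = analytic real_analytic2_on_Dx real_analytic2_on_Dy

lemma Dxy: "(x, y) \<in> U \<Longrightarrow> Dx (Dy F) x y = Dy (Dx F) x y"
  "(x, y) \<in> U \<Longrightarrow> Dx (Dy (Dx F)) x y = Dy (Dx (Dx F)) x y"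
  "(x, y) \<in> U \<Longrightarrow> Dx (Dy (Dx (Dx F))) x y = Dy (Dx (Dx (Dx F))) x y"
  by (intro Dx_Dy_commute[where U = U] analytic_intros, assumption)+

text \<open>The equality of \<open>Dx (Dy F)\<close> and \<open>Dy (Dx F)\<close> is known only on
  \<open>U\<close>, so it is carried through the outer \<open>Dy\<close> by comparing gradients on
  an open set.\<close>

lemma Dxyy:
  assumes "(x, y) \<in> U"
  shows "Dx (Dy (Dy F)) x y = Dy (Dy (Dx F)) x y"
proof -
  have 1: "has_grad (Dx (Dy F)) (Dx (Dx (Dy F)) x y) (Dy (Dx (Dy F)) x y) x y"
    by (intro has_gradI analytic_intros assms)
  have 2: "has_grad (Dx (Dy F)) (Dx (Dy (Dx F)) x y) (Dy (Dy (Dx F)) x y) x y"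
    by (rule has_grad_cong_open[where f = "Dy (Dx F)"])
      (auto intro!: has_gradI analytic_intros assms open_U simp: Dxy)
  have "Dx (Dy (Dy F)) x y = Dy (Dx (Dy F)) x y"
    by (intro Dx_Dy_commute[where U = U] analytic_intros assms)
  then show ?thesis using has_grad_unique(2)[OF 1 2] by simp
qed

lemma Dxy_m: "(x, y) \<in> U \<Longrightarrow> Dy (Dx F) x y = - m x y * Dx (Dx F) x y"
  using Fxx by (simp add: m_def)

lemma Dyy_m: "(x, y) \<in> U \<Longrightarrow> Dy (Dy F) x y = (m x y)\<^sup>2 * Dx (Dx F) x y"
  using Fxx[of x y] hessian[of x y] by (simp add: m_def field_simps power2_eq_square)

text \<open>Obtained by differentiating the vanishing Hessian determinant in \<open>x\<close>; it
  supplies the third derivative \<open>Dy (Dy (Dx F))\<close>, which enters the y-derivative of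
  \<open>m\<close>.\<close>

lemma hessian_x:
  assumes "(x, y) \<in> U"
  shows "Dx (Dx (Dx F)) x y * Dy (Dy F) x y + Dx (Dx F) x y * Dy (Dy (Dx F)) x y
    = 2 * Dy (Dx F) x y * Dy (Dx (Dx F)) x y"
proof -
  let ?H = "\<lambda>x y. Dx (Dx F) x y * Dy (Dy F) x y - Dy (Dx F) x y * Dy (Dx F) x y"
  have "has_grad ?H 0 0 x y"
    by (rule has_grad_cong_open[OF has_grad_const open_U assms])
      (use hessian in \<open>auto simp: power2_eq_square\<close>)
  moreover have "\<exists>q. has_grad ?H (Dx (Dx (Dx F)) x y * Dy (Dy F) x y + Dx (Dx F) x y * Dx (Dy (Dy F)) x y
      - (Dx (Dy (Dx F)) x y * Dy (Dx F) x y + Dy (Dx F) x y * Dx (Dy (Dx F)) x y)) q x y"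
    by (rule exI, (rule has_grad_diff has_grad_mult has_gradI analytic_intros assms)+)
  ultimately show ?thesis using has_grad_unique(1) by (fastforce simp: Dxy[OF assms] Dxyy[OF assms])
qed

text \<open>The y-component is Burgers' equation. The quotient rule produces
  \<open>Dy (Dy (Dx F))\<close>, which \<open>hessian_x\<close> eliminates.\<close>

lemma has_grad_m:
  assumes "(x, y) \<in> U"
  shows "has_grad m (mx x y) (- m x y * mx x y) x y"
proof -
  have "has_grad (\<lambda>x y. - Dy (Dx F) x y / Dx (Dx F) x y)
      ((- Dx (Dy (Dx F)) x y * Dx (Dx F) x y - (- Dy (Dx F) x y) * Dx (Dx (Dx F)) x y) / (Dx (Dx F) x y)\<^sup>2)
      ((- Dy (Dy (Dx F)) x y * Dx (Dx F) x y - (- Dy (Dx F) x y) * Dy (Dx (Dx F)) x y) / (Dx (Dx F) x y)\<^sup>2) x y"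
    by (intro has_grad_divide has_grad_minus has_gradI analytic_intros assms Fxx)
  moreover have "(\<lambda>x y. - Dy (Dx F) x y / Dx (Dx F) x y) = m" by (simp add: m_def fun_eq_iff)
  moreover have "(- Dx (Dy (Dx F)) x y * Dx (Dx F) x y - (- Dy (Dx F) x y) * Dx (Dx (Dx F)) x y)
      / (Dx (Dx F) x y)\<^sup>2 = mx x y"
    by (simp add: mx_def Dxy[OF assms] algebra_simps)
  moreover have "(- Dy (Dy (Dx F)) x y * Dx (Dx F) x y - (- Dy (Dx F) x y) * Dy (Dx (Dx F)) x y)
      / (Dx (Dx F) x y)\<^sup>2 = - m x y * mx x y"
  proof -
    have "Dx (Dx F) x y * Dy (Dy (Dx F)) x y = 2 * Dy (Dx F) x y * Dy (Dx (Dx F)) x y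
        - Dx (Dx (Dx F)) x y * Dy (Dy F) x y"
      using hessian_x[OF assms] by simp
    then show ?thesis using Fxx[OF assms] Dyy_m[OF assms] Dxy_m[OF assms]
      by (simp add: mx_def field_simps power2_eq_square)
  qed
  ultimately show ?thesis by metis
qed

text \<open>The y-derivative stays unspecified: later arguments need only its existence or eliminate
  it.\<close>

lemma has_grad_mx:
  assumes "(x, y) \<in> U"
  obtains q where "has_grad mx (mxx x y) q x y"
proof -
  let ?f = "\<lambda>x y. (Dy (Dx F) x y * Dx (Dx (Dx F)) x y - Dx (Dx F) x y * Dy (Dx (Dx F)) x y)
      / (Dx (Dx F) x y * Dx (Dx F) x y)"
  let ?n = "Dy (Dx F) x y * Dx (Dx (Dx F)) x y - Dx (Dx F) x y * Dy (Dx (Dx F)) x y"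
  have "\<exists>q. has_grad ?f (((Dx (Dy (Dx F)) x y * Dx (Dx (Dx F)) x y + Dy (Dx F) x y * Dx (Dx (Dx (Dx F))) x y
      - (Dx (Dx (Dx F)) x y * Dy (Dx (Dx F)) x y + Dx (Dx F) x y * Dx (Dy (Dx (Dx F))) x y))
        * (Dx (Dx F) x y * Dx (Dx F) x y)
      - ?n * (Dx (Dx (Dx F)) x y * Dx (Dx F) x y + Dx (Dx F) x y * Dx (Dx (Dx F)) x y))
      / (Dx (Dx F) x y * Dx (Dx F) x y)\<^sup>2) q x y"
    by (rule exI, (rule has_grad_divide has_grad_diff has_grad_mult has_gradI analytic_intros assms)+)
      (use Fxx[OF assms] in simp)
  then obtain q where q: "has_grad ?f (((Dx (Dy (Dx F)) x y * Dx (Dx (Dx F)) x y + Dy (Dx F) x y * Dx (Dx (Dx (Dx F))) x y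
      - (Dx (Dx (Dx F)) x y * Dy (Dx (Dx F)) x y + Dx (Dx F) x y * Dx (Dy (Dx (Dx F))) x y))
        * (Dx (Dx F) x y * Dx (Dx F) x y)
      - ?n * (Dx (Dx (Dx F)) x y * Dx (Dx F) x y + Dx (Dx F) x y * Dx (Dx (Dx F)) x y))
      / (Dx (Dx F) x y * Dx (Dx F) x y)\<^sup>2) q x y" (is "has_grad _ ?p _ _ _") ..
  moreover have "?f = mx" by (simp add: mx_def fun_eq_iff power2_eq_square)
  moreover have "?p = mxx x y"
    using Fxx[OF assms]
    by (simp add: mxx_def Dxy[OF assms] divide_simps power2_eq_square power3_eq_cube) algebra
  ultimately show ?thesis using that by metis
qed

text \<open>The second-order terms of the product rule cancel, because \<open>(m, 1)\<close> is in
  the kernel of the Hessian. What remains is \<open>Dx F\<close> times the gradient of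
  \<open>m\<close>.\<close>

lemma has_grad_k:
  assumes "(x, y) \<in> U"
  shows "has_grad k (mx x y * Dx F x y) (- m x y * mx x y * Dx F x y) x y"
proof -
  have "has_grad (\<lambda>x y. Dy F x y + m x y * Dx F x y)
      (Dx (Dy F) x y + (mx x y * Dx F x y + m x y * Dx (Dx F) x y))
      (Dy (Dy F) x y + (- m x y * mx x y * Dx F x y + m x y * Dy (Dx F) x y)) x y"
    by (intro has_grad_add has_grad_mult has_grad_m has_gradI analytic_intros assms)
  moreover have "(\<lambda>x y. Dy F x y + m x y * Dx F x y) = k" by (simp add: k_def fun_eq_iff)
  ultimately show ?thesis
    by (simp add: Dxy[OF assms] Dxy_m[OF assms] Dyy_m[OF assms] power2_eq_square)
qed

text \<open>Freezing the slope at its initial value \<open>M\<close> avoids solving the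
  characteristic equation: the deviation \<open>z\<close> of \<open>m\<close> from \<open>M\<close>
  along the straight segment satisfies \<open>z' = - mx * z\<close> by Burgers' equation and starts
  at 0. Then \<open>k\<close> has derivative 0 along the segment, and \<open>F\<close> has the
  constant derivative \<open>k x y\<close>.\<close>

lemma along_ruler:
  assumes seg: "\<And>s. s \<in> {-d..d} \<Longrightarrow> (x + s * m x y, y + s) \<in> U" and s: "s \<in> {-d..d}"
  shows "m (x + s * m x y) (y + s) = m x y"
    and "F (x + s * m x y) (y + s) = F x y + s * k x y"
proof -
  define M where "M = m x y"
  let ?I = "{-d..d}"
  have 0: "0 \<in> ?I" using s by auto
  have comp: "((\<lambda>s. g (x + s * M) (y + s)) has_real_derivative p * M + q) (at s within ?I)"
    if "has_grad g p q (x + s * M) (y + s)" for g p q s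
  proof -
    have "((\<lambda>s. x + s * M) has_real_derivative M) (at s within ?I)"
      "((\<lambda>s. y + s) has_real_derivative 1) (at s within ?I)"
      by (auto intro!: derivative_eq_intros)
    from has_grad_compose[where X = "\<lambda>s. x + s * M" and Y = "\<lambda>s. y + s", OF that this]
    show ?thesis by simp
  qed
  have in_U: "(x + s * M, y + s) \<in> U" if "s \<in> ?I" for s using seg that by (simp add: M_def)
  have m_eq: "m (x + s * M) (y + s) = M" if "s \<in> ?I" for s
  proof -
    define z where "z s = m (x + s * M) (y + s) - M" for s
    define c where "c s = - mx (x + s * M) (y + s)" for s
    have "z s = 0"
    proof (rule linear_ode_zero[where z = z and c = c, OF _ _ 0 _ that])
      show "(z has_real_derivative c s * z s) (at s within ?I)" if "s \<in> ?I" for s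
        unfolding z_def[abs_def] c_def
        by (rule derivative_eq_intros comp[OF has_grad_m[OF in_U[OF that]]] refl)+
          (simp add: algebra_simps)
      have "\<exists>D. (c has_real_derivative D) (at s within ?I)" if "s \<in> ?I" for s
        unfolding c_def[abs_def] using has_grad_mx[OF in_U[OF that]] comp DERIV_minus by metis
      then show "continuous_on ?I c"
        by (meson DERIV_continuous continuous_on_eq_continuous_within)
      show "z 0 = 0" by (simp add: z_def M_def)
    qed
    then show ?thesis by (simp add: z_def)
  qed
  then show "m (x + s * m x y) (y + s) = m x y" using s by (simp add: M_def)
  have const: "f s = f 0" if f: "\<And>s. s \<in> ?I \<Longrightarrow> (f has_real_derivative 0) (at s within ?I)"
    and s: "s \<in> ?I" for f :: "real \<Rightarrow> real" and s
  proof -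
    obtain v where "\<forall>s\<in>?I. f s = v" using has_field_derivative_zero_constant[of ?I f] f by auto
    then show ?thesis using s 0 by simp
  qed
  have "((\<lambda>s. k (x + s * M) (y + s)) has_real_derivative 0) (at s within ?I)" if "s \<in> ?I" for s
    using comp[OF has_grad_k[OF in_U[OF that]]] m_eq[OF that] by (simp add: algebra_simps)
  from const[OF this] have k_const: "k (x + s * M) (y + s) = k x y" if "s \<in> ?I" for s
    using that by simp
  have "((\<lambda>s. F (x + s * M) (y + s) - s * k x y) has_real_derivative 0) (at s within ?I)" if "s \<in> ?I" for s
  proof -
    have "Dx F (x + s * M) (y + s) * M + Dy F (x + s * M) (y + s) = k x y"
      using k_const[OF that] m_eq[OF that] unfolding k_def[of "x + s * M" "y + s"]
      by (simp add: add.commute mult.commute)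
    then show ?thesis
      by - (rule derivative_eq_intros comp[OF has_gradI[OF analytic in_U[OF that]]] refl | simp)+
  qed
  from const[OF this s] show "F (x + s * m x y) (y + s) = F x y + s * k x y" by (simp add: M_def)
qed

end

subsection \<open>Construction of rulings\<close>

lemma eventually_nhds_square:
  fixes a c :: real
  assumes "eventually P (nhds (a, c))"
  obtains \<delta> where "\<delta> > 0" "\<And>t s. \<bar>t - a\<bar> < \<delta> \<Longrightarrow> \<bar>s - c\<bar> < \<delta> \<Longrightarrow> P (t, s)"
proof -
  obtain d where d: "d > 0" "\<And>z. dist z (a, c) < d \<Longrightarrow> P z"
    using assms unfolding eventually_nhds_metric by blast
  have "P (t, s)" if "\<bar>t - a\<bar> < d / 2" "\<bar>s - c\<bar> < d / 2" for t s
  proof (rule d(2))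
    have "dist (t, s) (a, c) \<le> \<bar>t - a\<bar> + \<bar>s - c\<bar>"
      using sqrt_sum_squares_le_sum_abs[of "t - a" "s - c"]
      by (simp add: dist_Pair_Pair dist_real_def)
    then show "dist (t, s) (a, c) < d" using that by simp
  qed
  then show ?thesis using that[of "d / 2"] d(1) by simp
qed

lemma velocity_eqI:
  assumes "\<And>i. ((\<lambda>s. \<gamma> s $ i) has_real_derivative D $ i) (at t)"
  shows "velocity \<gamma> t = D"
  using assms has_vector_derivative_vec_nth_iff[of \<gamma> D t UNIV] vector_derivative_at by auto

context parabolic
begin

definition base :: "real \<Rightarrow> real \<Rightarrow> real ^ 3" where
  "base b t = vector [t, b, F t b]"

definition dir :: "real \<Rightarrow> real \<Rightarrow> real ^ 3" where
  "dir b t = vector [m t b, 1, k t b]"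

text \<open>The derivative of \<open>base b\<close>. The derivative of \<open>dir b\<close> is
  \<open>mx\<close> times the same vector, by \<open>has_grad_k\<close>.\<close>

definition tang :: "real \<Rightarrow> real \<Rightarrow> real ^ 3" where
  "tang b t = vector [1, 0, Dx F t b]"

lemma open_slice: "open {t. (t, b) \<in> U}"
proof -
  have "open ((\<lambda>t. (t, b)) -` U)"
    using open_U by (intro open_vimage continuous_intros)
  then show ?thesis by (simp add: vimage_def)
qed

lemma eventually_slice: "(t, b) \<in> U \<Longrightarrow> eventually (\<lambda>s. (s, b) \<in> U) (nhds t)"
  using eventually_nhds_in_open[OF open_slice, of t b] by simp

lemma analytic_slice:
  assumes "(t, b) \<in> U"
  shows "analytic_at1 (\<lambda>t. F t b) t" "analytic_at1 (\<lambda>t. m t b) t" "analytic_at1 (\<lambda>t. k t b) t"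
    "analytic_at1 (\<lambda>t. mx t b) t" "analytic_at1 (\<lambda>t. mxx t b) t"
proof -
  have slice: "analytic_at1 (\<lambda>t. g t b) t" if "real_analytic2_on g U" for g
    using real_analytic2_on_slice[OF that assms] .
  show "analytic_at1 (\<lambda>t. F t b) t" by (intro slice analytic_intros)
  show m: "analytic_at1 (\<lambda>t. m t b) t"
    unfolding m_def by (intro analytic_at1_divide analytic_at1_minus slice analytic_intros Fxx assms)
  show "analytic_at1 (\<lambda>t. k t b) t"
    unfolding k_def by (intro analytic_at1_add analytic_at1_mult m slice analytic_intros)
  have "eventually (\<lambda>s. deriv (\<lambda>t. m t b) s = mx s b) (nhds t)"
    using eventually_slice[OF assms]
    by eventually_elim (rule DERIV_imp_deriv, rule has_grad_partial_x, rule has_grad_m)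
  then show mx: "analytic_at1 (\<lambda>t. mx t b) t"
    using analytic_at1_deriv[OF m] by (simp add: analytic_at1_cong)
  have "eventually (\<lambda>s. deriv (\<lambda>t. mx t b) s = mxx s b) (nhds t)"
    using eventually_slice[OF assms]
    by eventually_elim (metis DERIV_imp_deriv has_grad_partial_x has_grad_mx)
  then show "analytic_at1 (\<lambda>t. mxx t b) t"
    using analytic_at1_deriv[OF mx] by (simp add: analytic_at1_cong)
qed

lemma deriv_slice:
  assumes "(t, b) \<in> U"
  shows "((\<lambda>t. F t b) has_real_derivative Dx F t b) (at t)"
    "((\<lambda>t. m t b) has_real_derivative mx t b) (at t)"
    "((\<lambda>t. k t b) has_real_derivative mx t b * Dx F t b) (at t)"
    "((\<lambda>t. mx t b) has_real_derivative mxx t b) (at t)"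
  using has_grad_partial_x has_gradI[OF analytic assms] has_grad_m[OF assms] has_grad_k[OF assms]
    has_grad_mx[OF assms] by metis+

text \<open>Covers both curves of a ruling: \<open>\<rho> = 1\<close> gives the base curve and
  \<open>\<rho> = 0\<close> the direction field. In either case the velocity lies in the span of
  \<open>tang\<close> and \<open>dir\<close>.\<close>

lemma
  assumes eq: "\<And>s. (s, b) \<in> U \<Longrightarrow> \<gamma> s = \<rho> *\<^sub>R base b s + \<sigma> s *\<^sub>R dir b s"
    and \<sigma>: "analytic_at1 \<sigma> t" and t: "(t, b) \<in> U"
  shows analytic_ruled: "analytic_at1 (\<lambda>s. \<gamma> s $ i) t"
    and velocity_ruled: "velocity \<gamma> t = (\<rho> + \<sigma> t * mx t b) *\<^sub>R tang b t + deriv \<sigma> t *\<^sub>R dir b t"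
proof -
  have ev: "eventually (\<lambda>s. \<gamma> s $ i = \<rho> * base b s $ i + \<sigma> s * dir b s $ i) (nhds t)" for i
    using eventually_slice[OF t] by eventually_elim (simp add: eq)
  have "\<forall>i. analytic_at1 (\<lambda>s. base b s $ i) t \<and> analytic_at1 (\<lambda>s. dir b s $ i) t"
    using analytic_slice[OF t] by (simp add: forall_3 base_def dir_def analytic_at1_const analytic_at1_id)
  then have "analytic_at1 (\<lambda>s. \<rho> * base b s $ i + \<sigma> s * dir b s $ i) t"
    by (intro analytic_at1_add analytic_at1_mult analytic_at1_const \<sigma>) auto
  then show "analytic_at1 (\<lambda>s. \<gamma> s $ i) t" using analytic_at1_cong[OF ev] by simp
  have base: "\<forall>i. ((\<lambda>s. base b s $ i) has_real_derivative tang b t $ i) (at t)"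
    using deriv_slice[OF t] by (simp add: forall_3 base_def tang_def)
  have dir: "\<forall>i. ((\<lambda>s. dir b s $ i) has_real_derivative mx t b * tang b t $ i) (at t)"
    using deriv_slice[OF t] by (simp add: forall_3 dir_def tang_def)
  show "velocity \<gamma> t = (\<rho> + \<sigma> t * mx t b) *\<^sub>R tang b t + deriv \<sigma> t *\<^sub>R dir b t"
  proof (rule velocity_eqI)
    fix i
    have "((\<lambda>s. \<rho> * base b s $ i + \<sigma> s * dir b s $ i) has_real_derivative
        ((\<rho> + \<sigma> t * mx t b) *\<^sub>R tang b t + deriv \<sigma> t *\<^sub>R dir b t) $ i) (at t)"
      by (rule derivative_eq_intros base[rule_format] dir[rule_format]
          analytic_at1_has_derivative[OF \<sigma>] refl)+ (simp add: algebra_simps)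
    then show "((\<lambda>s. \<gamma> s $ i) has_real_derivative
        ((\<rho> + \<sigma> t * mx t b) *\<^sub>R tang b t + deriv \<sigma> t *\<^sub>R dir b t) $ i) (at t)"
      using DERIV_cong_ev[OF refl ev refl] by blast
  qed
qed

text \<open>The freedom in \<open>\<sigma>\<close> and \<open>\<mu>\<close> lets one construction
  serve all three types: \<open>\<sigma> = 0\<close>, \<open>\<mu> = 1\<close> for cylinders and
  cones, the edge of regression and its velocity for tangential surfaces.\<close>

lemma ruled_neighbourhood:
  fixes \<sigma> \<mu> :: "real \<Rightarrow> real"
  assumes p: "(a, b) \<in> U"
    and an: "\<And>t. (t, b) \<in> U \<Longrightarrow> analytic_at1 \<sigma> t" "\<And>t. (t, b) \<in> U \<Longrightarrow> analytic_at1 \<mu> t"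
    and \<mu>0: "\<And>t. (t, b) \<in> U \<Longrightarrow> \<mu> t \<noteq> 0"
    and \<alpha>: "\<And>t. (t, b) \<in> U \<Longrightarrow> \<alpha> t = base b t + \<sigma> t *\<^sub>R dir b t"
    and w: "\<And>t. (t, b) \<in> U \<Longrightarrow> w t = \<mu> t *\<^sub>R dir b t"
  shows "\<exists>V I J. open V \<and> (a, b) \<in> V \<and> V \<subseteq> U \<and> a \<in> I \<and> is_interval I \<and> (\<forall>t\<in>I. (t, b) \<in> U) \<and>
    developable_by (graph_over F V) \<alpha> w I J"
proof -
  \<comment> \<open>Characteristic coordinates: start at \<open>(t, b)\<close> and move by
    \<open>s\<close> in \<open>y\<close> along the kernel direction.\<close>
  define \<Phi> where "\<Phi> z = (fst z + snd z * m (fst z) b, b + snd z)" for z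
  have cont1: "isCont (\<lambda>z. f (fst z)) (a, c)" if "analytic_at1 f a" for f :: "real \<Rightarrow> real" and c :: real
    using analytic_at1_has_derivative[OF that]
    by (intro isCont_o2[where f = fst and g = f]) (auto intro: DERIV_isCont)
  have m: "isCont (\<lambda>z. m (fst z) b) (a, c)" and mx: "isCont (\<lambda>z. mx (fst z) b) (a, c)" for c :: real
    using cont1 analytic_slice[OF p] by blast+
  have "isCont \<Phi> (a, 0)" unfolding \<Phi>_def by (intro continuous_intros m)
  moreover have "\<Phi> (a, 0) \<in> U" using p by (simp add: \<Phi>_def)
  ultimately have "eventually (\<lambda>z. \<Phi> z \<in> U) (nhds (a, 0))"
    using open_U by (simp add: isCont_def tendsto_at_iff_tendsto_nhds topological_tendstoD)
  \<comment> \<open>The Jacobian determinant of \<open>\<Phi>\<close> is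
    \<open>1 + s * mx t b\<close>; keeping \<open>s * mx t b\<close> below 1 in absolute value makes
    it nonzero, so the parameters stay away from the focal points.\<close>
  moreover define g where "g z = \<bar>snd z * mx (fst z) b\<bar>" for z
  have "isCont g (a, 0)" unfolding g_def by (intro continuous_intros mx)
  then have "eventually (\<lambda>z. g z < 1) (nhds (a, 0))"
    unfolding isCont_def tendsto_at_iff_tendsto_nhds by (rule order_tendstoD) (simp add: g_def)
  then have "eventually (\<lambda>z. \<bar>snd z * mx (fst z) b\<bar> < 1) (nhds (a, 0))" by (simp add: g_def)
  ultimately have "eventually (\<lambda>z. \<Phi> z \<in> U \<and> \<bar>snd z * mx (fst z) b\<bar> < 1) (nhds (a, 0))"
    by (rule eventually_conj)
  then obtain \<delta> where \<delta>: "\<delta> > 0"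
    "\<And>t s. \<bar>t - a\<bar> < \<delta> \<Longrightarrow> \<bar>s\<bar> < \<delta> \<Longrightarrow> \<Phi> (t, s) \<in> U"
    "\<And>t s. \<bar>t - a\<bar> < \<delta> \<Longrightarrow> \<bar>s\<bar> < \<delta> \<Longrightarrow> \<bar>s * mx t b\<bar> < 1"
    using eventually_nhds_square[of _ a 0] by (metis (no_types, lifting) diff_zero fst_conv snd_conv)
  have slice: "(t, b) \<in> U" if "\<bar>t - a\<bar> < \<delta>" for t
    using \<delta>(2)[OF that, of 0] \<delta>(1) by (simp add: \<Phi>_def)
  have ruler: "m (fst (\<Phi> (t, s))) (snd (\<Phi> (t, s))) = m t b"
    "F (fst (\<Phi> (t, s))) (snd (\<Phi> (t, s))) = F t b + s * k t b" if "\<bar>t - a\<bar> < \<delta>" "\<bar>s\<bar> < \<delta>" for t s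
  proof -
    have seg: "(t + s' * m t b, b + s') \<in> U" if s': "s' \<in> {- \<bar>s\<bar>..\<bar>s\<bar>}" for s'
    proof -
      have "\<bar>s'\<bar> \<le> \<bar>s\<bar>" using s' by (auto simp: abs_le_iff)
      then show ?thesis
        using \<delta>(2)[of t s'] \<open>\<bar>t - a\<bar> < \<delta>\<close> \<open>\<bar>s\<bar> < \<delta>\<close> by (simp add: \<Phi>_def)
    qed
    have "s \<in> {- \<bar>s\<bar>..\<bar>s\<bar>}" by (auto simp: abs_le_iff)
    from along_ruler[OF seg this]
    show "m (fst (\<Phi> (t, s))) (snd (\<Phi> (t, s))) = m t b"
      "F (fst (\<Phi> (t, s))) (snd (\<Phi> (t, s))) = F t b + s * k t b"
      by (auto simp: \<Phi>_def)
  qed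
  \<comment> \<open>In the ruling given by \<open>\<alpha>\<close> and \<open>w\<close>, the
    parameter \<open>v\<close> corresponds to the offset \<open>S (t, v)\<close> from the slice;
    \<open>v0\<close> is the parameter at which the ruler of \<open>a\<close> passes over
    \<open>(a, b)\<close>. It need not be 0, since \<open>\<alpha>\<close> may lie off the
    graph.\<close>
  define v0 where "v0 = - \<sigma> a / \<mu> a"
  define S where "S z = \<sigma> (fst z) + snd z * \<mu> (fst z)" for z
  have "S (a, v0) = 0" using \<mu>0[OF p] by (simp add: S_def v0_def)
  moreover have "isCont (\<lambda>z. \<bar>S z\<bar>) (a, v0)"
    unfolding S_def by (intro continuous_intros cont1 an p)
  ultimately have "((\<lambda>z. \<bar>S z\<bar>) \<longlongrightarrow> 0) (nhds (a, v0))"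
    using tendsto_at_iff_tendsto_nhds[of "\<lambda>z. \<bar>S z\<bar>" "(a, v0)"] by (simp add: isCont_def)
  then have "eventually (\<lambda>z. \<bar>S z\<bar> < \<delta>) (nhds (a, v0))"
    using \<delta>(1) by (rule order_tendstoD(2))
  then obtain \<epsilon> where \<epsilon>: "\<epsilon> > 0" "\<And>t v. \<bar>t - a\<bar> < \<epsilon> \<Longrightarrow> \<bar>v - v0\<bar> < \<epsilon> \<Longrightarrow> \<bar>S (t, v)\<bar> < \<delta>"
    using eventually_nhds_square by metis
  define I where "I = {a - min \<delta> \<epsilon><..<a + min \<delta> \<epsilon>}"
  define J where "J = {v0 - \<epsilon><..<v0 + \<epsilon>}"
  have I: "\<bar>t - a\<bar> < \<delta>" "\<bar>t - a\<bar> < \<epsilon>" if "t \<in> I" for t using that by (auto simp: I_def)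
  have S\<delta>: "\<bar>S (t, v)\<bar> < \<delta>" if "t \<in> I" "v \<in> J" for t v
    using that \<epsilon>(2)[of t v] I(2)[of t] by (auto simp: J_def)
  have IU: "(t, b) \<in> U" if "t \<in> I" for t using slice I(1) that by blast
  define \<psi> where "\<psi> z = \<Phi> (fst z, S z)" for z
  define V where "V = \<psi> ` (I \<times> J)"
  have point: "\<alpha> t + v *\<^sub>R w t = vector [fst (\<psi> (t, v)), snd (\<psi> (t, v)), F (fst (\<psi> (t, v))) (snd (\<psi> (t, v)))]"
    if "t \<in> I" "v \<in> J" for t v
    using ruler(2)[OF I(1)[OF that(1)] S\<delta>[OF that]]
    by (simp add: vec_eq_iff forall_3 \<psi>_def \<Phi>_def \<alpha>[OF IU[OF that(1)]] w[OF IU[OF that(1)]] base_def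
        dir_def S_def algebra_simps)
  \<comment> \<open>Equal second coordinates give equal offsets; constancy of \<open>m\<close> along
    rulers gives equal slopes; the first coordinates then give \<open>t = t'\<close>.\<close>
  have inj: "inj_on \<psi> (I \<times> J)"
  proof (rule inj_onI, clarify)
    fix t v t' v' assume I': "t \<in> I" "t' \<in> I" and J': "v \<in> J" "v' \<in> J" and eq: "\<psi> (t, v) = \<psi> (t', v')"
    have s: "S (t, v) = S (t', v')" using eq by (simp add: \<psi>_def \<Phi>_def)
    have "m t b = m t' b"
      using ruler(1)[OF I(1)[OF I'(1)] S\<delta>[OF I'(1) J'(1)]] ruler(1)[OF I(1)[OF I'(2)] S\<delta>[OF I'(2) J'(2)]] eq
      by (simp add: \<psi>_def)
    then have "t = t'" using eq s by (simp add: \<psi>_def \<Phi>_def)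
    then show "t = t' \<and> v = v'" using s \<mu>0[OF IU[OF I'(1)]] by (simp add: S_def)
  qed
  have cont: "continuous_on (I \<times> J) (\<lambda>z. f (fst z))" if "\<And>t. (t, b) \<in> U \<Longrightarrow> analytic_at1 f t" for f
  proof -
    have "isCont f t" if "t \<in> I" for t
      using analytic_at1_has_derivative \<open>\<And>t. (t, b) \<in> U \<Longrightarrow> analytic_at1 f t\<close> IU[OF that] DERIV_isCont by blast
    then have "continuous_on I f" by (simp add: continuous_at_imp_continuous_on)
    then show ?thesis by (rule continuous_on_compose2) (auto intro: continuous_intros)
  qed
  have "continuous_on (I \<times> J) \<psi>"
    unfolding \<psi>_def \<Phi>_def S_def fst_conv snd_conv
    by (intro continuous_intros cont an analytic_slice)
  \<comment> \<open>Invariance of domain: \<open>\<psi>\<close> is a continuous injection between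
    planes.\<close>
  then have "open V"
    unfolding V_def using inj by (intro invariance_of_domain) (auto simp: I_def J_def intro: open_Times)
  moreover have "\<psi> (a, v0) = (a, b)" using \<open>S (a, v0) = 0\<close> by (simp add: \<psi>_def \<Phi>_def)
  then have "(a, b) \<in> V"
    unfolding V_def using \<delta>(1) \<epsilon>(1) by (intro image_eqI[of _ _ "(a, v0)"]) (auto simp: I_def J_def)
  moreover have "V \<subseteq> U"
    unfolding V_def \<psi>_def using \<delta>(2) I(1) S\<delta> by auto
  moreover have "a \<in> I" "is_interval I" using \<delta>(1) \<epsilon>(1) by (auto simp: I_def is_interval_convex_1)
  moreover have "developable_by (graph_over F V) \<alpha> w I J"
  proof -
    have v\<alpha>: "velocity \<alpha> t = (1 + \<sigma> t * mx t b) *\<^sub>R tang b t + deriv \<sigma> t *\<^sub>R dir b t" if "t \<in> I" for t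
      by (rule velocity_ruled[where \<rho> = 1]) (use \<alpha> an IU[OF that] in auto)
    have vw: "velocity w t = (\<mu> t * mx t b) *\<^sub>R tang b t + deriv \<mu> t *\<^sub>R dir b t" if "t \<in> I" for t
      using velocity_ruled[where \<rho> = 0 and \<gamma> = w and \<sigma> = \<mu>] w an IU[OF that] by auto
    have "analytic_at1 (\<lambda>s. \<alpha> s $ i) t" if "t \<in> I" for t i
      by (rule analytic_ruled[where \<rho> = 1]) (use \<alpha> an IU[OF that] in auto)
    moreover have "analytic_at1 (\<lambda>s. w s $ i) t" if "t \<in> I" for t i
      by (rule analytic_ruled[where \<rho> = 0 and \<sigma> = \<mu>]) (use w an IU[OF that] in auto)
    ultimately have "real_analytic_curve_on \<alpha> I" "real_analytic_curve_on w I"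
      unfolding real_analytic_curve_on_components by blast+
    moreover have "inj_on (\<lambda>(t, v). \<alpha> t + v *\<^sub>R w t) (I \<times> J)"
    proof (rule inj_onI, clarify)
      fix t v t' v' assume A: "t \<in> I" "t' \<in> I" "v \<in> J" "v' \<in> J" "\<alpha> t + v *\<^sub>R w t = \<alpha> t' + v' *\<^sub>R w t'"
      then have "\<psi> (t, v) = \<psi> (t', v')"
        by (simp add: point prod_eq_iff vec_eq_iff forall_3)
      then show "t = t' \<and> v = v'" using inj A by (auto dest: inj_onD)
    qed
    moreover have "cross3 (velocity \<alpha> t + v *\<^sub>R velocity w t) (w t) \<noteq> 0" if t: "t \<in> I" and v: "v \<in> J" for t v
    proof
      assume "cross3 (velocity \<alpha> t + v *\<^sub>R velocity w t) (w t) = 0"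
      \<comment> \<open>The third component is the Jacobian of the ruling projected to the xy-plane,
        namely \<open>\<mu> t\<close> times the Jacobian of \<open>\<Phi>\<close> at
        \<open>S (t, v)\<close>.\<close>
      then have "cross3 (velocity \<alpha> t + v *\<^sub>R velocity w t) (w t) $ 3 = 0" by simp
      then have "\<mu> t * (1 + S (t, v) * mx t b) = 0"
        by (simp add: cross3_def v\<alpha>[OF t] vw[OF t] w[OF IU[OF t]] tang_def dir_def S_def algebra_simps)
      then show False
        using \<mu>0[OF IU[OF t]] \<delta>(3)[OF I(1)[OF t] S\<delta>[OF t v]] by (simp add: abs_less_iff)
    qed
    moreover have "graph_over F V = (\<lambda>(t, v). \<alpha> t + v *\<^sub>R w t) ` (I \<times> J)"
      unfolding graph_over_def V_def image_image using point
      by (intro image_cong refl) (auto simp: case_prod_unfold)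
    \<comment> \<open>All three vectors lie in the plane spanned by \<open>tang b t\<close> and
      \<open>dir b t\<close>.\<close>
    moreover have "det (vector [w t, velocity w t, velocity \<alpha> t] :: real ^ 3 ^ 3) = 0" if t: "t \<in> I" for t
      unfolding det_3
      by (simp add: v\<alpha>[OF t] vw[OF t] w[OF IU[OF t]] tang_def dir_def algebra_simps)
    ultimately show ?thesis
      unfolding developable_by_def ruled_by_def by (auto simp: I_def J_def is_interval_convex_1)
  qed
  ultimately show ?thesis using IU by blast
qed

end

subsection \<open>Rulings of a parabolic graph\<close>

lemma mem_graph_over:
  "z \<in> graph_over F V \<longleftrightarrow> (z $ 1, z $ 2) \<in> V \<and> z $ 3 = F (z $ 1) (z $ 2)"
  by (force simp: graph_over_def vec_eq_iff forall_3)

lemma DERIV_const_on_open: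
  fixes f :: "real \<Rightarrow> real"
  assumes "(f has_real_derivative D) (at t)" "open I" "t \<in> I" "\<And>s. s \<in> I \<Longrightarrow> f s = c"
  shows "D = 0"
proof -
  have "((\<lambda>s. c) has_real_derivative D) (at t)"
    using assms by (rule has_field_derivative_transform_within_open)
  then show ?thesis using DERIV_const DERIV_unique by blast
qed

lemma constant_on_interval:
  fixes f :: "real \<Rightarrow> real"
  assumes "is_interval I" "\<And>t. t \<in> I \<Longrightarrow> (f has_real_derivative 0) (at t)" "s \<in> I" "t \<in> I"
  shows "f s = f t"
  using has_field_derivative_zero_constant[of I f] assms
  by (metis is_interval_convex has_field_derivative_at_within)

lemma has_grad_fst: "has_grad (\<lambda>x y. x) 1 0 x y"
  unfolding has_grad_def by (auto intro!: derivative_eq_intros)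

lemma has_grad_snd: "has_grad (\<lambda>x y. y) 0 1 x y"
  unfolding has_grad_def by (auto intro!: derivative_eq_intros)

lemma ruled_byD:
  assumes "ruled_by M \<alpha> w I J"
  shows "open I" "is_interval I" "open J" "real_analytic_curve_on \<alpha> I" "real_analytic_curve_on w I"
    "\<And>t v. t \<in> I \<Longrightarrow> v \<in> J \<Longrightarrow> cross3 (velocity \<alpha> t + v *\<^sub>R velocity w t) (w t) \<noteq> 0"
    "M = (\<lambda>(t, v). \<alpha> t + v *\<^sub>R w t) ` (I \<times> J)"
  using assms unfolding ruled_by_def by blast+

context parabolic
begin

lemma ruled_point:
  assumes "ruled_by (graph_over F V) \<alpha> w I J" "t \<in> I" "v \<in> J"
  shows "(\<alpha> t $ 1 + v * w t $ 1, \<alpha> t $ 2 + v * w t $ 2) \<in> V"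
    "F (\<alpha> t $ 1 + v * w t $ 1) (\<alpha> t $ 2 + v * w t $ 2) = \<alpha> t $ 3 + v * w t $ 3"
proof -
  have "\<alpha> t + v *\<^sub>R w t \<in> graph_over F V"
    using ruled_byD(7)[OF assms(1)] assms(2,3) by auto
  then show "(\<alpha> t $ 1 + v * w t $ 1, \<alpha> t $ 2 + v * w t $ 2) \<in> V"
    "F (\<alpha> t $ 1 + v * w t $ 1) (\<alpha> t $ 2 + v * w t $ 2) = \<alpha> t $ 3 + v * w t $ 3"
    by (auto simp: mem_graph_over)
qed

text \<open>A line contained in the surface annihilates the second fundamental form, so it has the
  kernel direction.\<close>

lemma ruled_direction:
  assumes R: "ruled_by (graph_over F V) \<alpha> w I J" and VU: "V \<subseteq> U" and t: "t \<in> I" and v: "v \<in> J"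
  defines "x \<equiv> \<alpha> t $ 1 + v * w t $ 1" and "y \<equiv> \<alpha> t $ 2 + v * w t $ 2"
  shows "w t $ 1 = m x y * w t $ 2" "w t $ 2 \<noteq> 0" "w t $ 3 = Dx F x y * w t $ 1 + Dy F x y * w t $ 2"
proof -
  define X Y where "X v = \<alpha> t $ 1 + v * w t $ 1" and "Y v = \<alpha> t $ 2 + v * w t $ 2" for v
  have pt: "(X v, Y v) \<in> U" "F (X v) (Y v) = \<alpha> t $ 3 + v * w t $ 3" if "v \<in> J" for v
    using ruled_point[OF R t that] VU by (auto simp: X_def Y_def)
  have X: "(X has_real_derivative w t $ 1) (at v)" and Y: "(Y has_real_derivative w t $ 2) (at v)" for v
    unfolding X_def[abs_def] Y_def[abs_def] by (auto intro!: derivative_eq_intros)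
  note chain = has_grad_compose[OF _ X Y]
  have J: "open J" using ruled_byD(3)[OF R] .
  have first: "Dx F (X v) (Y v) * w t $ 1 + Dy F (X v) (Y v) * w t $ 2 = w t $ 3" if v: "v \<in> J" for v
  proof -
    have "((\<lambda>v. F (X v) (Y v) - v * w t $ 3) has_real_derivative
        Dx F (X v) (Y v) * w t $ 1 + Dy F (X v) (Y v) * w t $ 2 - w t $ 3) (at v)"
      by (rule derivative_eq_intros chain has_gradI[OF analytic pt(1)[OF v]] refl)+ simp
    then have "Dx F (X v) (Y v) * w t $ 1 + Dy F (X v) (Y v) * w t $ 2 - w t $ 3 = 0"
      by (rule DERIV_const_on_open[OF _ J v, where c = "\<alpha> t $ 3"]) (simp add: pt(2))
    then show ?thesis by simp
  qed
  have "((\<lambda>v. Dx F (X v) (Y v) * w t $ 1 + Dy F (X v) (Y v) * w t $ 2) has_real_derivative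
      (Dx (Dx F) (X v) (Y v) * w t $ 1 + Dy (Dx F) (X v) (Y v) * w t $ 2) * w t $ 1
      + (Dx (Dy F) (X v) (Y v) * w t $ 1 + Dy (Dy F) (X v) (Y v) * w t $ 2) * w t $ 2) (at v)"
    by (intro DERIV_add DERIV_cmult_right chain has_gradI[OF _ pt(1)[OF v]] analytic_intros)
  then have "(Dx (Dx F) (X v) (Y v) * w t $ 1 + Dy (Dx F) (X v) (Y v) * w t $ 2) * w t $ 1
      + (Dx (Dy F) (X v) (Y v) * w t $ 1 + Dy (Dy F) (X v) (Y v) * w t $ 2) * w t $ 2 = 0"
    by (rule DERIV_const_on_open[OF _ J v]) (rule first)
  \<comment> \<open>By parabolicity the Hessian form is a perfect square up to the factor
    \<open>Dx (Dx F)\<close>, so its vanishing on \<open>w\<close> is a linear condition.\<close>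
  then have "Dx (Dx F) (X v) (Y v) * (w t $ 1 - m (X v) (Y v) * w t $ 2)\<^sup>2 = 0"
    using pt(1)[OF v] by (simp add: Dxy Dxy_m Dyy_m power2_eq_square algebra_simps)
  then show w1: "w t $ 1 = m x y * w t $ 2"
    using Fxx[OF pt(1)[OF v]] by (simp add: X_def Y_def x_def y_def)
  show w3: "w t $ 3 = Dx F x y * w t $ 1 + Dy F x y * w t $ 2"
    using first[OF v] by (simp add: X_def Y_def x_def y_def)
  show "w t $ 2 \<noteq> 0"
  proof
    assume "w t $ 2 = 0"
    then have "w t = 0" using w1 w3 by (simp add: vec_eq_iff forall_3)
    then show False using ruled_byD(6)[OF R t v] by (simp add: cross3_def vec_eq_iff forall_3)
  qed
qed

lemma ruled_parameters:
  assumes R: "ruled_by (graph_over F V) \<alpha> w I J" and VU: "V \<subseteq> U" and xy: "(x, y) \<in> V"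
  obtains t v where "t \<in> I" "v \<in> J" "x = \<alpha> t $ 1 + v * w t $ 1" "y = \<alpha> t $ 2 + v * w t $ 2"
    "w t $ 1 = m x y * w t $ 2" "w t $ 2 \<noteq> 0"
proof -
  have "vector [x, y, F x y] \<in> graph_over F V" using xy by (simp add: mem_graph_over)
  then obtain t v where tv: "t \<in> I" "v \<in> J" "vector [x, y, F x y] = \<alpha> t + v *\<^sub>R w t"
    using ruled_byD(7)[OF R] by auto
  then have "x = \<alpha> t $ 1 + v * w t $ 1" "y = \<alpha> t $ 2 + v * w t $ 2"
    by (simp_all add: vec_eq_iff forall_3)
  then show ?thesis using that tv ruled_direction[OF R VU tv(1,2)] by simp
qed

section \<open>Conditions on \<open>m\<close> forced by a given ruling\<close>

lemma cylinder_imp: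
  assumes "locally_at is_cylinder F U (x, y)"
  shows "mx x y = 0"
proof -
  obtain V \<alpha> w I J where V: "open V" "(x, y) \<in> V" "V \<subseteq> U" and R: "ruled_by (graph_over F V) \<alpha> w I J"
    and par: "\<And>s t. s \<in> I \<Longrightarrow> t \<in> I \<Longrightarrow> \<exists>c. w s = c *\<^sub>R w t"
    using assms unfolding locally_at_def is_cylinder_def developable_by_def by blast
  obtain t0 v0 where t0: "t0 \<in> I" "w t0 $ 1 = m x y * w t0 $ 2" "w t0 $ 2 \<noteq> 0"
    using ruled_parameters[OF R V(3,2)] by metis
  \<comment> \<open>Every point of \<open>V\<close> lies on some ruler, and \<open>m\<close> there
    is the ratio of the first two components of its direction, which parallel rulers share.\<close>
  have const: "m x' y' = m x y" if xy: "(x', y') \<in> V" for x' y'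
  proof -
    obtain t where t: "t \<in> I" "w t $ 1 = m x' y' * w t $ 2" "w t $ 2 \<noteq> 0"
      using ruled_parameters[OF R V(3) xy] by metis
    obtain c where "w t = c *\<^sub>R w t0" using par t(1) t0(1) by blast
    then show ?thesis using t t0 by auto
  qed
  have "(x, y) \<in> U" using V by blast
  then have "has_grad (\<lambda>x' y'. m x y) (mx x y) (- m x y * mx x y) x y"
    by (rule has_grad_cong_open[OF has_grad_m V(1,2) const])
  then show ?thesis using has_grad_unique(1)[OF _ has_grad_const] by blast
qed

text \<open>If all rulers pass through \<open>q\<close>, then \<open>m(x, y)\<close> is the slope of the line through \<open>(x, y)\<close>
  and \<open>(q\<^sub>1, q\<^sub>2)\<close>, which is affine in \<open>x\<close>.\<close>

lemma cone_imp:
  assumes "locally_at is_cone F U (x, y)"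
  shows "mx x y \<noteq> 0" "mxx x y = 0"
proof -
  obtain V \<alpha> w I J q where V: "open V" "(x, y) \<in> V" "V \<subseteq> U" and R: "ruled_by (graph_over F V) \<alpha> w I J"
    and q: "\<And>t. t \<in> I \<Longrightarrow> q \<in> ruler \<alpha> w t"
    using assms unfolding locally_at_def is_cone_def developable_by_def by blast
  define c d where "c = q $ 1" and "d = q $ 2"
  have m: "m x y * (d - y) + x = c" if xy: "(x, y) \<in> V" for x y
  proof -
    obtain t v where t: "t \<in> I" "x = \<alpha> t $ 1 + v * w t $ 1" "y = \<alpha> t $ 2 + v * w t $ 2"
      "w t $ 1 = m x y * w t $ 2"
      using ruled_parameters[OF R V(3) xy] by metis
    obtain u where "q = \<alpha> t + u *\<^sub>R w t" using q[OF t(1)] unfolding ruler_def by blast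
    then have q12: "c = \<alpha> t $ 1 + u * w t $ 1" "d = \<alpha> t $ 2 + u * w t $ 2" by (simp_all add: c_def d_def)
    have "c - x = (u - v) * (m x y * w t $ 2)"
      unfolding q12(1) using t(2,4) by (simp add: algebra_simps)
    moreover have "d - y = (u - v) * w t $ 2"
      unfolding q12(2) using t(3) by (simp add: algebra_simps)
    ultimately have "m x y * (d - y) = c - x" by (metis mult.left_commute)
    then show ?thesis by simp
  qed
  \<comment> \<open>The x-derivative of the previous identity. It shows both that \<open>mx\<close>
    is nonzero and that \<open>y\<close> differs from \<open>d\<close>; the second fact makes the
    next derivative yield \<open>mxx = 0\<close>.\<close>
  have mx: "mx x y * (d - y) + 1 = 0" if xy: "(x, y) \<in> V" for x y
  proof -
    have U: "(x, y) \<in> U" using xy V by blast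
    have "\<exists>r. has_grad (\<lambda>x y. m x y * (d - y) + x) (mx x y * (d - y) + m x y * (0 - 0) + 1) r x y"
      by (rule exI, (rule has_grad_add has_grad_mult has_grad_diff has_grad_m[OF U] has_grad_const
            has_grad_fst has_grad_snd)+)
    then obtain r where "has_grad (\<lambda>x y. m x y * (d - y) + x) (mx x y * (d - y) + 1) r x y" by auto
    from has_grad_cong_open[OF this V(1) xy m] show ?thesis
      using has_grad_unique(1)[OF _ has_grad_const] by blast
  qed
  have U: "(x, y) \<in> U" using V by blast
  obtain r' where r': "has_grad mx (mxx x y) r' x y" using has_grad_mx[OF U] .
  have "\<exists>r. has_grad (\<lambda>x y. mx x y * (d - y) + 1) (mxx x y * (d - y) + mx x y * (0 - 0) + 0) r x y"
    by (rule exI, (rule has_grad_add has_grad_mult has_grad_diff r' has_grad_const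
          has_grad_fst has_grad_snd)+)
  then obtain r where "has_grad (\<lambda>x y. mx x y * (d - y) + 1) (mxx x y * (d - y)) r x y" by auto
  from has_grad_cong_open[OF this V(1,2) mx] have "mxx x y * (d - y) = 0"
    using has_grad_unique(1)[OF _ has_grad_const] by blast
  then show "mx x y \<noteq> 0" "mxx x y = 0" using mx[OF V(2)] by auto
qed

text \<open>The key is \<open>mx1\<close>: the offset \<open>- 1 / mx\<close> from a point to the
  focal point of its ruler equals \<open>- v * w t $ 2\<close>, which leads back to
  \<open>\<alpha> t\<close>. Differentiating \<open>mx1\<close> in both parameters rules out
  \<open>mxx = 0\<close>.\<close>

lemma tangential_imp:
  assumes "locally_at is_tangential F U (x, y)"
  shows "mx x y \<noteq> 0" "mxx x y \<noteq> 0"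
proof -
  obtain V \<alpha> I J where V: "open V" "(x, y) \<in> V" "V \<subseteq> U"
    and R: "ruled_by (graph_over F V) \<alpha> (velocity \<alpha>) I J"
    using assms unfolding locally_at_def is_tangential_def developable_by_def by blast
  define w where "w = velocity \<alpha>"
  define w' where "w' = velocity w"
  note R = R[folded w_def]
  define X Y where "X t v = \<alpha> t $ 1 + v * w t $ 1" and "Y t v = \<alpha> t $ 2 + v * w t $ 2" for t v
  note I = ruled_byD(1)[OF R] and J = ruled_byD(3)[OF R]
  have pt: "(X t v, Y t v) \<in> U" "F (X t v) (Y t v) = \<alpha> t $ 3 + v * w t $ 3" if "t \<in> I" "v \<in> J" for t v
    using ruled_point[OF R that] V(3) by (auto simp: X_def Y_def)
  have w1: "w t $ 1 = m (X t v) (Y t v) * w t $ 2" and w2: "w t $ 2 \<noteq> 0"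
    and w3: "w t $ 3 = Dx F (X t v) (Y t v) * w t $ 1 + Dy F (X t v) (Y t v) * w t $ 2"
    if "t \<in> I" "v \<in> J" for t v
    using ruled_direction[OF R V(3) that] by (auto simp: X_def Y_def)
  have d\<alpha>: "((\<lambda>s. \<alpha> s $ i) has_real_derivative w t $ i) (at t)"
    and dw: "((\<lambda>s. w s $ i) has_real_derivative w' t $ i) (at t)" if "t \<in> I" for t i
    using real_analytic_curve_on_velocity_nth[OF ruled_byD(4)[OF R] that]
      real_analytic_curve_on_velocity_nth[OF ruled_byD(5)[OF R] that] by (auto simp: w_def w'_def)
  have Xt: "((\<lambda>t. X t v) has_real_derivative w t $ 1 + v * w' t $ 1) (at t)"
    and Yt: "((\<lambda>t. Y t v) has_real_derivative w t $ 2 + v * w' t $ 2) (at t)" if "t \<in> I" for t v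
    unfolding X_def Y_def by (intro DERIV_add DERIV_cmult d\<alpha> dw that)+
  have Xv: "(X t has_real_derivative w t $ 1) (at v)" and Yv: "(Y t has_real_derivative w t $ 2) (at v)" for t v
    unfolding X_def[abs_def] Y_def[abs_def] by (auto intro!: derivative_eq_intros)
  have mx1: "mx (X t v) (Y t v) * (v * w t $ 2) = 1" if t: "t \<in> I" and v: "v \<in> J" for t v
  proof -
    let ?x = "X t v" and ?y = "Y t v"
    have imm: "cross3 (w t + v *\<^sub>R w' t) (w t) \<noteq> 0"
      using ruled_byD(6)[OF R t v] by (simp add: w_def w'_def)
    then have v0: "v \<noteq> 0" by auto
    \<comment> \<open>Differentiating the kernel condition in \<open>t\<close> at fixed
      \<open>v\<close>: by Burgers' equation the result factors, one factor being the claim.\<close>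
    have "((\<lambda>t. m (X t v) (Y t v) * w t $ 2 - w t $ 1) has_real_derivative
        (mx ?x ?y * (w t $ 1 + v * w' t $ 1) + - m ?x ?y * mx ?x ?y * (w t $ 2 + v * w' t $ 2)) * w t $ 2
        + w' t $ 2 * m ?x ?y - w' t $ 1) (at t)"
      by (intro DERIV_diff DERIV_mult has_grad_compose[where X = "\<lambda>t. X t v" and Y = "\<lambda>t. Y t v"]
          has_grad_m pt t v Xt Yt dw)
    then have "(mx ?x ?y * (w t $ 1 + v * w' t $ 1) + - m ?x ?y * mx ?x ?y * (w t $ 2 + v * w' t $ 2)) * w t $ 2
        + w' t $ 2 * m ?x ?y - w' t $ 1 = 0"
      by (rule DERIV_const_on_open[OF _ I t]) (use w1 v in auto)
    then have "(w' t $ 1 - m ?x ?y * w' t $ 2) * (mx ?x ?y * (v * w t $ 2) - 1) = 0"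
      using w1[OF t v] by (simp add: algebra_simps)
    moreover have "w' t $ 1 - m ?x ?y * w' t $ 2 \<noteq> 0"
    proof
      \<comment> \<open>If the other factor vanished, \<open>w'\<close> would project to the kernel
        direction. It is also tangent to the graph, as the t-derivative of the height shows after
        division by \<open>v\<close>; so it would be a multiple of \<open>w\<close>, against the
        immersion condition.\<close>
      assume D: "w' t $ 1 - m ?x ?y * w' t $ 2 = 0"
      have "((\<lambda>t. F (X t v) (Y t v) - (\<alpha> t $ 3 + v * w t $ 3)) has_real_derivative
          (Dx F ?x ?y * (w t $ 1 + v * w' t $ 1) + Dy F ?x ?y * (w t $ 2 + v * w' t $ 2))
          - (w t $ 3 + v * w' t $ 3)) (at t)"
        by (intro DERIV_diff DERIV_add DERIV_cmult d\<alpha> dw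
            has_grad_compose[where X = "\<lambda>t. X t v" and Y = "\<lambda>t. Y t v"] has_gradI analytic pt t v Xt Yt)
      then have "(Dx F ?x ?y * (w t $ 1 + v * w' t $ 1) + Dy F ?x ?y * (w t $ 2 + v * w' t $ 2))
          - (w t $ 3 + v * w' t $ 3) = 0"
        by (rule DERIV_const_on_open[OF _ I t]) (use pt(2) v in auto)
      then have "v * (Dx F ?x ?y * w' t $ 1 + Dy F ?x ?y * w' t $ 2 - w' t $ 3) = 0"
        using w3[OF t v] by (simp add: algebra_simps)
      then have "w' t $ 3 = Dx F ?x ?y * w' t $ 1 + Dy F ?x ?y * w' t $ 2" using v0 by simp
      then have "w t $ 2 * w' t $ i = w' t $ 2 * w t $ i" for i
        using D w1[OF t v] w3[OF t v] by (cases i rule: exhaust_3[THEN disjE]) (auto simp: algebra_simps)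
      then have "w' t = (w' t $ 2 / w t $ 2) *\<^sub>R w t"
        using w2[OF t v] by (simp add: vec_eq_iff field_simps)
      then show False using imm by (metis cross_add_left cross_mult_left cross_refl scaleR_zero_right add_0)
    qed
    ultimately show ?thesis by simp
  qed
  obtain t v where tv: "t \<in> I" "v \<in> J" "x = X t v" "y = Y t v"
    using ruled_parameters[OF R V(3,2)] unfolding X_def Y_def by metis
  show mx: "mx x y \<noteq> 0" using mx1[OF tv(1,2)] tv(3,4) by auto
  show "mxx x y \<noteq> 0"
  proof
    assume 0: "mxx x y = 0"
    \<comment> \<open>With \<open>mxx = 0\<close> only the y-derivative \<open>r\<close> of
      \<open>mx\<close> remains. The v-derivative of \<open>mx1\<close> determines
      \<open>r * (v * w t $ 2)\<close>; inserting this into the t-derivative cancels all terms with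
      \<open>w'\<close> and leaves \<open>w t $ 2 * mx = 0\<close>.\<close>
    obtain r where r: "has_grad mx 0 r (X t v) (Y t v)"
      using has_grad_mx[OF pt(1)[OF tv(1,2)]] 0 tv(3,4) by metis
    have "((\<lambda>v. mx (X t v) (Y t v) * (v * w t $ 2)) has_real_derivative
        (0 * w t $ 1 + r * w t $ 2) * (v * w t $ 2) + (1 * w t $ 2) * mx (X t v) (Y t v)) (at v)"
      by (intro DERIV_mult DERIV_cmult_right DERIV_ident has_grad_compose[OF r Xv Yv])
    then have "(0 * w t $ 1 + r * w t $ 2) * (v * w t $ 2) + (1 * w t $ 2) * mx (X t v) (Y t v) = 0"
      by (rule DERIV_const_on_open[OF _ J tv(2)]) (use mx1 tv in auto)
    then have "w t $ 2 * (r * (v * w t $ 2) + mx (X t v) (Y t v)) = 0"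
      by (simp add: algebra_simps)
    then have A: "r * (v * w t $ 2) = - mx (X t v) (Y t v)" using w2[OF tv(1,2)] by simp
    have "((\<lambda>t. mx (X t v) (Y t v) * (v * w t $ 2)) has_real_derivative
        (0 * (w t $ 1 + v * w' t $ 1) + r * (w t $ 2 + v * w' t $ 2)) * (v * w t $ 2)
        + (v * w' t $ 2) * mx (X t v) (Y t v)) (at t)"
      by (intro DERIV_mult DERIV_cmult dw tv
          has_grad_compose[where X = "\<lambda>t. X t v" and Y = "\<lambda>t. Y t v"] r Xt Yt)
    then have "(0 * (w t $ 1 + v * w' t $ 1) + r * (w t $ 2 + v * w' t $ 2)) * (v * w t $ 2)
        + (v * w' t $ 2) * mx (X t v) (Y t v) = 0"
      by (rule DERIV_const_on_open[OF _ I tv(1)]) (use mx1 tv in auto)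
    then have "(w t $ 2 + v * w' t $ 2) * (r * (v * w t $ 2)) + (v * w' t $ 2) * mx (X t v) (Y t v) = 0"
      by (simp add: algebra_simps)
    then have "w t $ 2 * mx (X t v) (Y t v) = 0" unfolding A by (simp add: algebra_simps)
    then show False using w2[OF tv(1,2)] mx tv(3,4) by simp
  qed
qed

section \<open>Explicit rulings from the conditions on \<open>m\<close>\<close>

lemma imp_cylinder:
  assumes p: "(a, b) \<in> U" and mx0: "\<And>x y. (x, y) \<in> U \<Longrightarrow> mx x y = 0"
  shows "locally_at is_cylinder F U (a, b)"
proof -
  obtain V I J where V: "open V" "(a, b) \<in> V" "V \<subseteq> U"
    and I: "is_interval I" "\<And>t. t \<in> I \<Longrightarrow> (t, b) \<in> U"
    and dev: "developable_by (graph_over F V) (base b) (dir b) I J"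
    using ruled_neighbourhood[OF p, of "\<lambda>t. 0" "\<lambda>t. 1" "base b" "dir b"]
    by (auto simp: analytic_at1_const)
  have "dir b s = 1 *\<^sub>R dir b t" if "s \<in> I" "t \<in> I" for s t
  proof -
    \<comment> \<open>The derivative of \<open>k\<close> on the slice also carries the factor
      \<open>mx\<close>, so the full space direction is constant.\<close>
    have "m s b = m t b" "k s b = k t b"
      using constant_on_interval[OF I(1) _ that, of "\<lambda>t. m t b"]
        constant_on_interval[OF I(1) _ that, of "\<lambda>t. k t b"] deriv_slice(2,3)[OF I(2)] mx0[OF I(2)] by auto
    then show ?thesis by (simp add: dir_def)
  qed
  then have "is_cylinder (graph_over F V)"
    using dev unfolding is_cylinder_def by blast
  then show ?thesis using V unfolding locally_at_def by blast
qed

text \<open>On the slice \<open>mx\<close> is a constant \<open>c\<close>, so all focal points have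
  parameter \<open>- 1 / c\<close>. The focal point does not move, because \<open>base\<close> and
  \<open>dir\<close> have derivatives \<open>tang\<close> and \<open>c\<close> times
  \<open>tang\<close>.\<close>

lemma imp_cone:
  assumes p: "(a, b) \<in> U" and mx: "\<And>x y. (x, y) \<in> U \<Longrightarrow> mx x y \<noteq> 0"
    and mxx: "\<And>x y. (x, y) \<in> U \<Longrightarrow> mxx x y = 0"
  shows "locally_at is_cone F U (a, b)"
proof -
  obtain V I J where V: "open V" "(a, b) \<in> V" "V \<subseteq> U"
    and I: "a \<in> I" "is_interval I" "\<And>t. t \<in> I \<Longrightarrow> (t, b) \<in> U"
    and dev: "developable_by (graph_over F V) (base b) (dir b) I J"
    using ruled_neighbourhood[OF p, of "\<lambda>t. 0" "\<lambda>t. 1" "base b" "dir b"]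
    by (auto simp: analytic_at1_const)
  define c where "c = mx a b"
  have c0: "c \<noteq> 0" using mx[OF p] by (simp add: c_def)
  have c: "mx t b = c" if "t \<in> I" for t
    unfolding c_def
    using constant_on_interval[OF I(2) _ that I(1), of "\<lambda>t. mx t b"] deriv_slice(4)[OF I(3)] mxx[OF I(3)] by auto
  define q where "q = base b a + (- 1 / c) *\<^sub>R dir b a"
  have "q \<in> ruler (base b) (dir b) t" if t: "t \<in> I" for t
  proof -
    have "t - m t b / c = a - m a b / c"
    proof (rule constant_on_interval[OF I(2) _ t I(1)])
      fix s assume "s \<in> I"
      show "((\<lambda>t. t - m t b / c) has_real_derivative 0) (at s)"
        by (rule derivative_eq_intros deriv_slice[OF I(3)[OF \<open>s \<in> I\<close>]] refl)+
          (use c0 c[OF \<open>s \<in> I\<close>] in auto)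
    qed
    moreover have "F t b - k t b / c = F a b - k a b / c"
    proof (rule constant_on_interval[OF I(2) _ t I(1)])
      fix s assume "s \<in> I"
      show "((\<lambda>t. F t b - k t b / c) has_real_derivative 0) (at s)"
        by (rule derivative_eq_intros deriv_slice[OF I(3)[OF \<open>s \<in> I\<close>]] refl)+
          (use c0 c[OF \<open>s \<in> I\<close>] in auto)
    qed
    ultimately have "q = base b t + (- 1 / c) *\<^sub>R dir b t"
      by (simp add: q_def vec_eq_iff forall_3 base_def dir_def)
    then show ?thesis unfolding ruler_def by blast
  qed
  then have "is_cone (graph_over F V)"
    using dev unfolding is_cone_def by blast
  then show ?thesis using V unfolding locally_at_def by blast
qed

text \<open>The edge of regression meets the ruler through \<open>(t, b)\<close> at the parameter \<open>- 1 / m\<^sub>x\<close>, where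
  the projected rulers have their envelope.\<close>

lemma imp_tangential:
  assumes p: "(a, b) \<in> U" and mx: "\<And>x y. (x, y) \<in> U \<Longrightarrow> mx x y \<noteq> 0"
    and mxx: "\<And>x y. (x, y) \<in> U \<Longrightarrow> mxx x y \<noteq> 0"
  shows "locally_at is_tangential F U (a, b)"
proof -
  define \<sigma> where "\<sigma> t = - 1 / mx t b" for t
  \<comment> \<open>The derivative of \<open>\<sigma>\<close>. Since
    \<open>1 + \<sigma> * mx = 0\<close>, the velocity of \<open>\<alpha>\<close> is exactly
    \<open>\<mu>\<close> times \<open>dir\<close>, and \<open>mxx\<close> being nonzero makes the
    edge regular.\<close>
  define \<mu> where "\<mu> t = mxx t b / (mx t b * mx t b)" for t
  define \<alpha> where "\<alpha> t = base b t + \<sigma> t *\<^sub>R dir b t" for t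
  have an: "analytic_at1 \<sigma> t" "analytic_at1 \<mu> t" if "(t, b) \<in> U" for t
    unfolding \<sigma>_def[abs_def] \<mu>_def[abs_def]
    by (intro analytic_at1_divide analytic_at1_mult analytic_at1_const analytic_slice that;
        use mx[OF that] in simp)+
  have w: "velocity \<alpha> t = \<mu> t *\<^sub>R dir b t" if "(t, b) \<in> U" for t
  proof -
    have "(\<sigma> has_real_derivative \<mu> t) (at t)"
      unfolding \<sigma>_def[abs_def] \<mu>_def
      by (rule derivative_eq_intros deriv_slice[OF that] mx[OF that] refl)+ simp
    then have "deriv \<sigma> t = \<mu> t" by (rule DERIV_imp_deriv)
    then show ?thesis
      using velocity_ruled[where \<rho> = 1 and \<gamma> = \<alpha> and \<sigma> = \<sigma>, OF _ an(1)[OF that] that] mx[OF that]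
      by (simp add: \<alpha>_def \<sigma>_def)
  qed
  obtain V I J where V: "open V" "(a, b) \<in> V" "V \<subseteq> U"
    and dev: "developable_by (graph_over F V) \<alpha> (velocity \<alpha>) I J"
  proof -
    have "\<mu> t \<noteq> 0" if "(t, b) \<in> U" for t using mx[OF that] mxx[OF that] by (simp add: \<mu>_def)
    then show ?thesis
      using ruled_neighbourhood[OF p an _ \<alpha>_def w] that by blast
  qed
  have "is_tangential (graph_over F V)"
    using dev unfolding is_tangential_def by blast
  then show ?thesis using V unfolding locally_at_def by blast
qed

section \<open>Translation into the invariants\<close>

lemma inv_S_mx: "inv_S F x y = - mx x y"
  by (simp add: inv_S_def mx_def Let_def minus_divide_left)

text \<open>\<open>inv_W\<close> is \<open>- mxx\<close> times \<open>Dx (Dx F)\<close> divided by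
  the square of the cube root of \<open>Dx (Dx F) ^ 2 * inv_S\<close>. Where \<open>inv_S\<close>
  vanishes, division by zero would make \<open>inv_W\<close> zero whatever \<open>mxx\<close>
  is.\<close>

lemma inv_W_mxx:
  assumes "(x, y) \<in> U" "inv_S F x y \<noteq> 0"
  shows "inv_W F x y = 0 \<longleftrightarrow> mxx x y = 0"
  using assms Fxx[OF assms(1)] by (simp add: inv_W_def inv_S_def mxx_def Let_def) (rule eq_commute)

end

theorem theorem22p1:
  fixes F :: "real \<Rightarrow> real \<Rightarrow> real" and U :: "(real \<times> real) set" and p :: "real \<times> real"
  assumes "open U"
    and "real_analytic2_on F U"
    and "\<forall>(x, y) \<in> U. Dx (Dx F) x y \<noteq> 0"
    and "\<forall>(x, y) \<in> U. Dx (Dx F) x y * Dy (Dy F) x y - (Dy (Dx F) x y)\<^sup>2 = 0"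
    and "(\<forall>(x, y) \<in> U. inv_S F x y = 0) \<or> (\<forall>(x, y) \<in> U. inv_S F x y \<noteq> 0)"
    and "(\<forall>(x, y) \<in> U. inv_S F x y \<noteq> 0) \<longrightarrow>
           (\<forall>(x, y) \<in> U. inv_W F x y = 0) \<or> (\<forall>(x, y) \<in> U. inv_W F x y \<noteq> 0)"
    and "p \<in> U"
  shows "(locally_at is_cylinder F U p \<longleftrightarrow> (\<forall>(x, y) \<in> U. inv_S F x y = 0)) \<and>
         (locally_at is_cone F U p \<longleftrightarrow>
           (\<forall>(x, y) \<in> U. inv_S F x y \<noteq> 0) \<and> (\<forall>(x, y) \<in> U. inv_W F x y = 0)) \<and>
         (locally_at is_tangential F U p \<longleftrightarrow>
           (\<forall>(x, y) \<in> U. inv_S F x y \<noteq> 0) \<and> (\<forall>(x, y) \<in> U. inv_W F x y \<noteq> 0))"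
proof -
  interpret parabolic F U using assms(1-4) by unfold_locales auto
  obtain a b where p: "p = (a, b)" by (cases p)
  have ab: "(a, b) \<in> U" using assms(7) p by simp
  have S: "inv_S F x y = 0 \<longleftrightarrow> mx x y = 0" for x y by (simp add: inv_S_mx)
  have W: "inv_W F x y = 0 \<longleftrightarrow> mxx x y = 0" if "(x, y) \<in> U" "mx x y \<noteq> 0" for x y
    using inv_W_mxx[OF that(1)] that(2) by (simp add: S)
  \<comment> \<open>The ruling gives \<open>mx = 0\<close> only at \<open>(a, b)\<close>; the
    dichotomy for \<open>inv_S\<close> extends this to \<open>U\<close>. The other two cases use
    both dichotomies in the same way.\<close>
  have cyl: "locally_at is_cylinder F U p \<longleftrightarrow> (\<forall>(x, y) \<in> U. inv_S F x y = 0)"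
    using cylinder_imp imp_cylinder assms(5) ab unfolding p S by blast
  have cone: "locally_at is_cone F U p \<longleftrightarrow>
      (\<forall>(x, y) \<in> U. inv_S F x y \<noteq> 0) \<and> (\<forall>(x, y) \<in> U. inv_W F x y = 0)"
    using cone_imp[of a b] imp_cone[OF ab] assms(5,6) ab W unfolding p S by blast
  have "locally_at is_tangential F U p \<longleftrightarrow>
      (\<forall>(x, y) \<in> U. inv_S F x y \<noteq> 0) \<and> (\<forall>(x, y) \<in> U. inv_W F x y \<noteq> 0)"
    using tangential_imp[of a b] imp_tangential[OF ab] assms(5,6) ab W unfolding p S by blast
  then show ?thesis using cyl cone by blast
qed

end
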